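(* For every $\mathbf{a}\in l^{2}$ and every $t\in\mathbb{R}$, $$e^{tH}\mathbf{a}=\mathbf{a}+t\,\mathrm{sinc}(t)\,H\mathbf{a}+t\sum_{k\in\mathbb{Z}\setminus\{0\}}\frac{e^{kH}\mathbf{a}-\mathbf{a}}{k}\,\mathrm{sinc}(t-k),$$ where the series converges in the norm of $l^{2}$.
   Context: $l^{2}$ is the Hilbert space of square-summable complex sequences $\mathbf{a}=(a_n)_{n\in\mathbb{Z}}$. $H:l^2\to l^2$ is the bounded operator $H=\pi\widetilde H$, where $\widetilde H$ is the discrete Hilbert transform; explicitly $(H\mathbf{a})_m=\sum_{n\in\mathbb{Z},\,n\neq m}\frac{a_n}{m-n}$, $m\in\mathbb{Z}$. For $t\in\mathbb{R}$, $e^{tH}=\sum_{k=0}^{\infty}\frac{t^kH^k}{k!}$. The function $\mathrm{sinc}$ is $\mathrm{sinc}(t)=\frac{\sin(\pi t)}{\pi t}$ for $t\neq0$, $\mathrm{sinc}(0)=1$. *)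

theory Defs
  imports "HOL-Analysis.Analysis"
begin

definition square_summable :: "(int \<Rightarrow> complex) \<Rightarrow> bool" where
  "square_summable a \<longleftrightarrow> (\<lambda>n. (cmod (a n))\<^sup>2) summable_on UNIV"

lemma square_summableI:
  assumes "\<And>F. finite F \<Longrightarrow> (\<Sum>n\<in>F. (cmod (a n))\<^sup>2) \<le> C"
  shows "square_summable a"
  unfolding square_summable_def
  by (rule nonneg_bdd_above_summable_on) (use assms in \<open>auto intro!: bdd_aboveI\<close>)

lemma square_summable_zero: "square_summable (\<lambda>_. 0)"
  by (rule square_summableI[of _ 0]) simp

lemma cmod_add_sq_le: "(cmod (x + y))\<^sup>2 \<le> 2 * (cmod x)\<^sup>2 + 2 * (cmod y)\<^sup>2"
proof -
  have "(cmod (x + y))\<^sup>2 \<le> (cmod x + cmod y)\<^sup>2"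
    by (intro power_mono norm_triangle_ineq) auto
  also have "\<dots> \<le> 2 * (cmod x)\<^sup>2 + 2 * (cmod y)\<^sup>2"
    using sum_squares_bound[of "cmod x" "cmod y"] by (simp add: power2_sum)
  finally show ?thesis .
qed

lemma square_summable_add:
  assumes "square_summable a" "square_summable b"
  shows "square_summable (\<lambda>n. a n + b n)"
  unfolding square_summable_def
proof (rule summable_on_comparison_test)
  show "(\<lambda>n. 2 * (cmod (a n))\<^sup>2 + 2 * (cmod (b n))\<^sup>2) summable_on UNIV"
    using assms unfolding square_summable_def
    by (intro summable_on_add summable_on_cmult_right)
qed (use cmod_add_sq_le in auto)

lemma square_summable_scaleR:
  "square_summable a \<Longrightarrow> square_summable (\<lambda>n. r *\<^sub>R a n)"
  unfolding square_summable_def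
  by (simp add: power_mult_distrib summable_on_cmult_right)

lemma square_summable_uminus: "square_summable a \<Longrightarrow> square_summable (\<lambda>n. - a n)"
  unfolding square_summable_def by simp

typedef ell2 = "{a. square_summable a}"
  morphisms ell2_nth Abs_ell2
  using square_summable_zero by blast

setup_lifting type_definition_ell2

lemma ell2_eqI: "(\<And>n. ell2_nth a n = ell2_nth b n) \<Longrightarrow> a = b"
  by (metis ell2_nth_inject ext)

lemma square_summable_ell2_nth: "square_summable (ell2_nth a)"
  using ell2_nth[of a] by simp

instantiation ell2 :: real_vector
begin

lift_definition zero_ell2 :: ell2 is "\<lambda>_. 0"
  by (rule square_summable_zero)

lift_definition plus_ell2 :: "ell2 \<Rightarrow> ell2 \<Rightarrow> ell2" is "\<lambda>a b n. a n + b n"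
  by (rule square_summable_add)

lift_definition uminus_ell2 :: "ell2 \<Rightarrow> ell2" is "\<lambda>a n. - a n"
  by (rule square_summable_uminus)

lift_definition minus_ell2 :: "ell2 \<Rightarrow> ell2 \<Rightarrow> ell2" is "\<lambda>a b n. a n - b n"
  using square_summable_add square_summable_uminus by fastforce

lift_definition scaleR_ell2 :: "real \<Rightarrow> ell2 \<Rightarrow> ell2" is "\<lambda>r a n. r *\<^sub>R a n"
  by (rule square_summable_scaleR)

instance
  by standard (transfer; simp add: fun_eq_iff algebra_simps)+

end

lemma inner_summable:
  assumes "square_summable a" "square_summable b"
  shows "(\<lambda>n. a n \<bullet> b n) summable_on UNIV"
proof (rule abs_summable_summable, rule summable_on_comparison_test)
  show "(\<lambda>n. (cmod (a n))\<^sup>2 + (cmod (b n))\<^sup>2) summable_on UNIV"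
    using assms unfolding square_summable_def by (intro summable_on_add)
  fix n
  have "norm (a n \<bullet> b n) \<le> cmod (a n) * cmod (b n)"
    using Cauchy_Schwarz_ineq2[of "a n" "b n"] by simp
  also have "\<dots> \<le> 2 * cmod (a n) * cmod (b n)" by simp
  also have "\<dots> \<le> (cmod (a n))\<^sup>2 + (cmod (b n))\<^sup>2"
    by (rule sum_squares_bound)
  finally show "norm (a n \<bullet> b n) \<le> (cmod (a n))\<^sup>2 + (cmod (b n))\<^sup>2" .
qed auto

text \<open>The class \<open>real_inner\<close> asks for a real bilinear form: this is the real part of the
  complex inner product of the space, and induces the same norm.\<close>

instantiation ell2 :: real_inner
begin

definition inner_ell2 :: "ell2 \<Rightarrow> ell2 \<Rightarrow> real" where
  "inner_ell2 a b = (\<Sum>\<^sub>\<infinity>n. Re (ell2_nth a n * cnj (ell2_nth b n)))"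

definition norm_ell2 :: "ell2 \<Rightarrow> real" where
  "norm_ell2 a = sqrt (\<Sum>\<^sub>\<infinity>n. (cmod (ell2_nth a n))\<^sup>2)"

definition dist_ell2 :: "ell2 \<Rightarrow> ell2 \<Rightarrow> real" where
  "dist_ell2 a b = norm (a - b)"

definition sgn_ell2 :: "ell2 \<Rightarrow> ell2" where
  "sgn_ell2 a = a /\<^sub>R norm a"

definition uniformity_ell2 :: "(ell2 \<times> ell2) filter" where
  "uniformity_ell2 = (INF e\<in>{0<..}. principal {(a, b). dist a b < e})"

definition open_ell2 :: "ell2 set \<Rightarrow> bool" where
  "open_ell2 S \<longleftrightarrow> (\<forall>x\<in>S. \<forall>\<^sub>F (x', y) in uniformity. x' = x \<longrightarrow> y \<in> S)"

instance
proof
  have inner_eq: "inner a b = (\<Sum>\<^sub>\<infinity>n. ell2_nth a n \<bullet> ell2_nth b n)" for a b :: ell2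
    by (simp add: inner_ell2_def inner_complex_def)
  have inner_sq: "inner a a = (\<Sum>\<^sub>\<infinity>n. (cmod (ell2_nth a n))\<^sup>2)" for a :: ell2
    by (simp add: inner_eq dot_square_norm)
  fix a b c :: ell2 and r :: real
  show "dist a b = norm (a - b)" by (rule dist_ell2_def)
  show "sgn a = a /\<^sub>R norm a" by (rule sgn_ell2_def)
  show "uniformity = (INF e\<in>{0<..}. principal {(x, y). dist (x::ell2) y < e})"
    by (rule uniformity_ell2_def)
  show "open U \<longleftrightarrow> (\<forall>x\<in>U. \<forall>\<^sub>F (x', y) in uniformity. x' = x \<longrightarrow> y \<in> U)" for U :: "ell2 set"
    by (rule open_ell2_def)
  show "inner a b = inner b a" by (simp add: inner_eq inner_commute)
  show "inner (a + b) c = inner a c + inner b c"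
    by (simp add: inner_eq plus_ell2.rep_eq inner_add_left infsum_add inner_summable
        square_summable_ell2_nth)
  show "inner (r *\<^sub>R a) b = r * inner a b"
    by (simp add: inner_eq scaleR_ell2.rep_eq infsum_cmult_right')
  show "0 \<le> inner a a" by (simp add: inner_sq infsum_nonneg)
  show "inner a a = 0 \<longleftrightarrow> a = 0"
  proof
    assume "inner a a = 0"
    then have "(cmod (ell2_nth a n))\<^sup>2 = 0" for n
      using square_summable_ell2_nth[of a] unfolding inner_sq square_summable_def
      by (intro nonneg_infsum_le_0D[of "\<lambda>n. (cmod (ell2_nth a n))\<^sup>2" UNIV]) auto
    then show "a = 0" by (intro ell2_eqI) (simp add: zero_ell2.rep_eq)
  qed (simp add: inner_eq zero_ell2.rep_eq)
  show "norm a = sqrt (inner a a)" by (simp add: inner_sq norm_ell2_def)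
qed

end

lemma norm_ell2_sq: "(norm a)\<^sup>2 = (\<Sum>\<^sub>\<infinity>n. (cmod (ell2_nth a n))\<^sup>2)"
  by (simp add: norm_ell2_def infsum_nonneg)

lemma finite_sum_le_norm_ell2:
  assumes "finite F"
  shows "(\<Sum>n\<in>F. (cmod (ell2_nth a n))\<^sup>2) \<le> (norm a)\<^sup>2"
  unfolding norm_ell2_sq
  using assms square_summable_ell2_nth[of a] unfolding square_summable_def
  by (intro finite_sum_le_infsum) auto

lemma norm_ell2_sq_leI:
  assumes "\<And>F. finite F \<Longrightarrow> (\<Sum>n\<in>F. (cmod (ell2_nth a n))\<^sup>2) \<le> C"
  shows "(norm a)\<^sup>2 \<le> C"
  unfolding norm_ell2_sq
  using assms square_summable_ell2_nth[of a] unfolding square_summable_def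
  by (intro infsum_le_finite_sums) auto

lemma cmod_ell2_nth_le: "cmod (ell2_nth a n) \<le> norm a"
  by (rule power2_le_imp_le) (use finite_sum_le_norm_ell2[of "{n}" a] in auto)

instance ell2 :: banach
proof
  fix X :: "nat \<Rightarrow> ell2"
  assume "Cauchy X"
  have "Cauchy (\<lambda>i. ell2_nth (X i) n)" for n
  proof (rule metric_CauchyI)
    fix e :: real
    assume "e > 0"
    then obtain M where M: "\<And>i j. i \<ge> M \<Longrightarrow> j \<ge> M \<Longrightarrow> dist (X i) (X j) < e"
      using \<open>Cauchy X\<close> by (meson metric_CauchyD)
    have "dist (ell2_nth (X i) n) (ell2_nth (X j) n) < e" if "i \<ge> M" "j \<ge> M" for i j
      using cmod_ell2_nth_le[of "X i - X j" n] M[OF that]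
      by (simp add: dist_norm minus_ell2.rep_eq)
    then show "\<exists>M. \<forall>i\<ge>M. \<forall>j\<ge>M. dist (ell2_nth (X i) n) (ell2_nth (X j) n) < e" by blast
  qed
  then have "\<exists>l. (\<lambda>i. ell2_nth (X i) n) \<longlonglongrightarrow> l" for n
    by (simp add: Cauchy_convergent_iff convergent_def)
  then obtain b where b: "\<And>n. (\<lambda>i. ell2_nth (X i) n) \<longlonglongrightarrow> b n" by metis
  have fatou: "(\<Sum>n\<in>F. (cmod (b n - ell2_nth (X i) n))\<^sup>2) \<le> e\<^sup>2"
    if "finite F" "e > 0" and M: "\<forall>i\<ge>M. \<forall>j\<ge>M. dist (X i) (X j) < e" and "i \<ge> M" for F M i e
  proof (rule Lim_bounded)
    show "(\<lambda>j. \<Sum>n\<in>F. (cmod (ell2_nth (X j) n - ell2_nth (X i) n))\<^sup>2)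
        \<longlonglongrightarrow> (\<Sum>n\<in>F. (cmod (b n - ell2_nth (X i) n))\<^sup>2)"
      by (intro tendsto_intros b)
    show "\<forall>j\<ge>M. (\<Sum>n\<in>F. (cmod (ell2_nth (X j) n - ell2_nth (X i) n))\<^sup>2) \<le> e\<^sup>2"
    proof (intro allI impI)
      fix j assume "j \<ge> M"
      have "(\<Sum>n\<in>F. (cmod (ell2_nth (X j) n - ell2_nth (X i) n))\<^sup>2) \<le> (norm (X j - X i))\<^sup>2"
        using finite_sum_le_norm_ell2[OF \<open>finite F\<close>, of "X j - X i"]
        by (simp add: minus_ell2.rep_eq)
      also have "\<dots> \<le> e\<^sup>2"
        using M \<open>i \<ge> M\<close> \<open>j \<ge> M\<close> \<open>e > 0\<close> by (intro power_mono) (auto simp: dist_norm less_imp_le)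
      finally show "(\<Sum>n\<in>F. (cmod (ell2_nth (X j) n - ell2_nth (X i) n))\<^sup>2) \<le> e\<^sup>2" .
    qed
  qed
  obtain M1 where "\<forall>i\<ge>M1. \<forall>j\<ge>M1. dist (X i) (X j) < 1"
    using \<open>Cauchy X\<close> by (meson metric_CauchyD zero_less_one)
  then have "square_summable (\<lambda>n. b n - ell2_nth (X M1) n)"
    using fatou[of _ 1 M1 M1] by (intro square_summableI[of _ "1\<^sup>2"]) auto
  from square_summable_add[OF this square_summable_ell2_nth[of "X M1"]]
  have "square_summable b" by simp
  define L where "L = Abs_ell2 b"
  have L: "ell2_nth L = b"
    unfolding L_def using \<open>square_summable b\<close> by (simp add: Abs_ell2_inverse)
  have "X \<longlonglongrightarrow> L"
  proof (rule metric_LIMSEQ_I)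
    fix e :: real
    assume "e > 0"
    then have "e / 2 > 0" by simp
    then obtain M where M: "\<forall>i\<ge>M. \<forall>j\<ge>M. dist (X i) (X j) < e / 2"
      using \<open>Cauchy X\<close> by (meson metric_CauchyD)
    have "dist (X i) L < e" if "i \<ge> M" for i
    proof -
      have "(norm (L - X i))\<^sup>2 \<le> (e / 2)\<^sup>2"
      proof (rule norm_ell2_sq_leI)
        fix F :: "int set"
        assume "finite F"
        from fatou[OF this \<open>e / 2 > 0\<close> M that]
        show "(\<Sum>n\<in>F. (cmod (ell2_nth (L - X i) n))\<^sup>2) \<le> (e / 2)\<^sup>2"
          unfolding minus_ell2.rep_eq L .
      qed
      then have "norm (L - X i) \<le> e / 2"
        by (rule power2_le_imp_le) (use \<open>e > 0\<close> in simp)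
      then show ?thesis using \<open>e > 0\<close> by (simp add: dist_norm norm_minus_commute)
    qed
    then show "\<exists>no. \<forall>i\<ge>no. dist (X i) L < e" by blast
  qed
  show "convergent X" using \<open>X \<longlonglongrightarrow> L\<close> by (rule convergentI)
qed

text \<open>Schur's argument: the kernel of the adjoint composed with the operator is summed explicitly.
  Division by zero gives zero, so the diagonal term drops out of the finite sums below.\<close>

definition inv_sq_total :: real where
  "inv_sq_total = (\<Sum>\<^sub>\<infinity>j::int. 1 / (of_int j)\<^sup>2)"

lemma inv_sq_summable: "(\<lambda>j::int. 1 / (real_of_int j)\<^sup>2) summable_on UNIV"
proof -
  have nat: "(\<lambda>n::nat. 1 / (real n)\<^sup>2) summable_on UNIV"
    using inverse_power_summable[of 2, where 'a = real]
    by (intro summable_nonneg_imp_summable_on) (auto simp: inverse_eq_divide power_one_over)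
  have "(\<lambda>j::int. 1 / (real_of_int j)\<^sup>2) summable_on range int"
    using nat by (subst summable_on_reindex) (auto simp: o_def)
  moreover have "(\<lambda>j::int. 1 / (real_of_int j)\<^sup>2) summable_on range (\<lambda>n. - int n)"
    using nat by (subst summable_on_reindex) (auto simp: o_def inj_on_def)
  moreover have "range int \<union> range (\<lambda>n. - int n) = UNIV"
    by (auto intro: int_cases2)
  ultimately show ?thesis by (metis summable_on_union)
qed

lemma inv_sq_finite_le:
  assumes "finite F" "inj_on f F"
  shows "(\<Sum>x\<in>F. 1 / (real_of_int (f x))\<^sup>2) \<le> inv_sq_total"
proof -
  have "(\<Sum>x\<in>F. 1 / (real_of_int (f x))\<^sup>2) = (\<Sum>j\<in>f ` F. 1 / (real_of_int j)\<^sup>2)"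
    using assms by (simp add: sum.reindex)
  also have "\<dots> \<le> inv_sq_total"
    unfolding inv_sq_total_def using assms inv_sq_summable by (intro finite_sum_le_infsum) auto
  finally show ?thesis .
qed

definition trunc_recip :: "nat \<Rightarrow> int \<Rightarrow> real" where
  "trunc_recip N n = (\<Sum>m\<in>{- int N..int N}. 1 / of_int (m - n))"

lemma trunc_recip_0: "trunc_recip N 0 = 0"
proof -
  have "trunc_recip N 0 = (\<Sum>m\<in>{- int N..int N}. 1 / of_int (- m))"
    unfolding trunc_recip_def
    by (rule sum.reindex_bij_witness[of _ uminus uminus]) auto
  also have "\<dots> = - trunc_recip N 0"
    unfolding trunc_recip_def by (simp add: sum_negf)
  finally show ?thesis by simp
qed

lemma trunc_recip_step:
  "trunc_recip N (n + 1) =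
     trunc_recip N n + 1 / of_int (- int N - 1 - n) - 1 / of_int (int N - n)"
proof -
  have "trunc_recip N (n + 1) = (\<Sum>m\<in>{- int N - 1..int N - 1}. 1 / of_int (m - n))"
    unfolding trunc_recip_def
    by (rule sum.reindex_bij_witness[of _ "\<lambda>m. m + 1" "\<lambda>m. m - 1"]) (auto simp: algebra_simps)
  moreover have "{- int N - 1..int N} = insert (- int N - 1) {- int N..int N}"
    "{- int N - 1..int N} = insert (int N) {- int N - 1..int N - 1}" by auto
  then have "(\<Sum>m\<in>insert (- int N - 1) {- int N..int N}. 1 / real_of_int (m - n)) =
      (\<Sum>m\<in>insert (int N) {- int N - 1..int N - 1}. 1 / of_int (m - n))" by simp
  ultimately show ?thesis
    unfolding trunc_recip_def by (simp add: algebra_simps)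
qed

lemma trunc_recip_tendsto: "(\<lambda>N. trunc_recip N n) \<longlonglongrightarrow> 0"
proof -
  have lim: "(\<lambda>N. 1 / real_of_int (- int N - 1 - n)) \<longlonglongrightarrow> 0"
    "(\<lambda>N. 1 / real_of_int (int N - n)) \<longlonglongrightarrow> 0" for n
  proof -
    have pos: "filterlim (\<lambda>N. c + real N) at_infinity sequentially" for c :: real
      by (intro filterlim_at_top_imp_at_infinity
          filterlim_tendsto_add_at_top[OF tendsto_const filterlim_real_sequentially])
    have lim_pos: "(\<lambda>N. x / (c + real N)) \<longlonglongrightarrow> 0" for c x :: real
      by (rule tendsto_divide_0[OF tendsto_const pos])
    have "1 / real_of_int (- int N - 1 - n) = (- 1) / ((1 + real_of_int n) + real N)" for N
      by (simp add: minus_divide_left[symmetric] minus_divide_right algebra_simps)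
    then show "(\<lambda>N. 1 / real_of_int (- int N - 1 - n)) \<longlonglongrightarrow> 0"
      by (simp only: lim_pos)
    have "1 / real_of_int (int N - n) = 1 / (- real_of_int n + real N)" for N
      by simp
    then show "(\<lambda>N. 1 / real_of_int (int N - n)) \<longlonglongrightarrow> 0"
      by (simp only: lim_pos)
  qed
  show ?thesis
  proof (induction n rule: int_induct[of _ 0])
    case base
    show ?case by (simp add: trunc_recip_0)
  next
    case (step1 i)
    show ?case
      unfolding trunc_recip_step using tendsto_diff[OF tendsto_add[OF step1(2) lim(1)] lim(2)]
      by simp
  next
    case (step2 i)
    have "trunc_recip N (i - 1) = trunc_recip N i - 1 / of_int (- int N - 1 - (i - 1))
        + 1 / of_int (int N - (i - 1))" for N
      using trunc_recip_step[of N "i - 1"] by simp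
    then show ?case
      using tendsto_add[OF tendsto_diff[OF step2(2) lim(1)[of "i - 1"]] lim(2)[of "i - 1"]]
      by simp
  qed
qed

definition trunc_gram :: "nat \<Rightarrow> int \<Rightarrow> int \<Rightarrow> real" where
  "trunc_gram N n k = (\<Sum>m\<in>{- int N..int N}. 1 / of_int (m - n) * (1 / of_int (m - k)))"

definition gram_bound :: "int \<Rightarrow> real" where
  "gram_bound j = (if j = 0 then inv_sq_total else 2 / (of_int j)\<^sup>2)"

lemma trunc_gram_le:
  "\<bar>trunc_gram N n k\<bar> \<le> gram_bound (n - k) + \<bar>trunc_recip N n\<bar> + \<bar>trunc_recip N k\<bar>"
proof (cases "n = k")
  case True
  have "inj_on (\<lambda>m. m - k) {- int N..int N}" by (auto simp: inj_on_def)
  from inv_sq_finite_le[OF _ this]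
  have "trunc_gram N n k \<le> inv_sq_total"
    unfolding trunc_gram_def True by (simp add: power2_eq_square)
  moreover have "0 \<le> trunc_gram N n k"
    unfolding trunc_gram_def True by (intro sum_nonneg) simp
  ultimately show ?thesis using True by (simp add: gram_bound_def)
next
  case False
  define d where "d = real_of_int (n - k)"
  have "1 \<le> \<bar>n - k\<bar>" using False by linarith
  then have d: "1 \<le> \<bar>d\<bar>" unfolding d_def by linarith
  have "1 / of_int (m - n) * (1 / of_int (m - k)) =
      (1 / of_int (m - n) - 1 / of_int (m - k)) / d
      + ((if m = n then 1 / d\<^sup>2 else 0) + (if m = k then 1 / d\<^sup>2 else 0))" for m :: int
  proof -
    consider "m = n" | "m = k" | "m \<noteq> n" "m \<noteq> k" by blast
    then show ?thesis
    proof cases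
      case 1
      then show ?thesis using False by (simp add: d_def power2_eq_square)
    next
      case 2
      then have "1 / real_of_int (m - n) = - (1 / d)"
        by (simp add: d_def) (metis minus_diff_eq minus_divide_right)
      then show ?thesis using 2 False by (simp add: power2_eq_square)
    next
      case 3
      then have "real_of_int (m - n) \<noteq> 0" "real_of_int (m - k) \<noteq> 0" by simp_all
      moreover have "d = real_of_int (m - k) - real_of_int (m - n)" by (simp add: d_def)
      ultimately show ?thesis using 3 d by (simp add: diff_frac_eq)
    qed
  qed
  then have "trunc_gram N n k = (trunc_recip N n - trunc_recip N k) / d
      + ((\<Sum>m\<in>{- int N..int N}. if m = n then 1 / d\<^sup>2 else 0)
        + (\<Sum>m\<in>{- int N..int N}. if m = k then 1 / d\<^sup>2 else 0))"
    unfolding trunc_gram_def trunc_recip_def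
    by (simp add: sum.distrib sum_divide_distrib[symmetric] sum_subtractf[symmetric])
  moreover have "\<bar>(trunc_recip N n - trunc_recip N k) / d\<bar> \<le> \<bar>trunc_recip N n\<bar> + \<bar>trunc_recip N k\<bar>"
  proof -
    have "\<bar>(trunc_recip N n - trunc_recip N k) / d\<bar> \<le> \<bar>trunc_recip N n - trunc_recip N k\<bar> / 1"
      unfolding abs_divide using d by (intro divide_left_mono) auto
    then show ?thesis
      using abs_triangle_ineq4[of "trunc_recip N n" "trunc_recip N k"] by simp
  qed
  moreover
  have delta: "\<bar>\<Sum>m\<in>{- int N..int N}. if m = j then 1 / d\<^sup>2 else 0\<bar> \<le> 1 / d\<^sup>2" for j
    by (simp add: sum.delta)
  note delta[of n] delta[of k]
  moreover have "gram_bound (n - k) = 1 / d\<^sup>2 + 1 / d\<^sup>2"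
    using False by (simp add: gram_bound_def d_def)
  ultimately show ?thesis by linarith
qed

lemma gram_bound_sum_le:
  assumes "finite F"
  shows "(\<Sum>k\<in>F. gram_bound (n - k)) \<le> 3 * inv_sq_total"
proof -
  have pos: "0 \<le> inv_sq_total" unfolding inv_sq_total_def by (intro infsum_nonneg) auto
  have "gram_bound (n - k) = (if n = k then inv_sq_total else 0) + 2 * (1 / (of_int (n - k))\<^sup>2)" for k
    by (simp add: gram_bound_def)
  then have "(\<Sum>k\<in>F. gram_bound (n - k)) =
      (\<Sum>k\<in>F. if n = k then inv_sq_total else 0) + 2 * (\<Sum>k\<in>F. 1 / (of_int (n - k))\<^sup>2)"
    by (simp only: sum.distrib sum_distrib_left)
  also have "(\<Sum>k\<in>F. if n = k then inv_sq_total else 0) \<le> inv_sq_total"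
    using pos by (simp add: assms)
  also have "(\<Sum>k\<in>F. 1 / (real_of_int (n - k))\<^sup>2) \<le> inv_sq_total"
    using assms by (intro inv_sq_finite_le) (auto simp: inj_on_def)
  finally show ?thesis by simp
qed

lemma hilbert_finite_bound:
  fixes a :: "int \<Rightarrow> complex"
  assumes "finite F" "finite M"
  shows "(\<Sum>m\<in>M. (cmod (\<Sum>n\<in>F. a n / of_int (m - n)))\<^sup>2)
      \<le> 3 * inv_sq_total * (\<Sum>n\<in>F. (cmod (a n))\<^sup>2)"
proof -
  define S where "S N = (\<Sum>m\<in>{- int N..int N}. (cmod (\<Sum>n\<in>F. a n / of_int (m - n)))\<^sup>2)" for N
  define E where "E N = (\<Sum>n\<in>F. \<Sum>k\<in>F. cmod (a n) * cmod (a k) *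
      (gram_bound (n - k) + \<bar>trunc_recip N n\<bar> + \<bar>trunc_recip N k\<bar>))" for N
  define E0 where "E0 = (\<Sum>n\<in>F. \<Sum>k\<in>F. cmod (a n) * cmod (a k) * gram_bound (n - k))"
  have S_eq: "of_real (S N) = (\<Sum>n\<in>F. \<Sum>k\<in>F. a n * cnj (a k) * of_real (trunc_gram N n k))" for N
  proof -
    have "of_real (S N) = (\<Sum>m\<in>{- int N..int N}. \<Sum>n\<in>F. \<Sum>k\<in>F.
        a n * cnj (a k) * of_real (1 / of_int (m - n) * (1 / of_int (m - k))))"
      unfolding S_def of_real_sum complex_norm_square
      by (simp add: sum_product mult_ac)
    also have "\<dots> = (\<Sum>n\<in>F. \<Sum>k\<in>F. \<Sum>m\<in>{- int N..int N}.
        a n * cnj (a k) * of_real (1 / of_int (m - n) * (1 / of_int (m - k))))"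
      by (subst sum.swap, rule sum.cong[OF refl], subst sum.swap, rule refl)
    finally show ?thesis
      unfolding trunc_gram_def of_real_sum sum_distrib_left .
  qed
  have S_le: "S N \<le> E N" for N
  proof -
    have "S N = cmod (of_real (S N))"
      unfolding norm_of_real S_def by (simp add: sum_nonneg)
    also have "\<dots> \<le> (\<Sum>n\<in>F. \<Sum>k\<in>F. cmod (a n * cnj (a k) * of_real (trunc_gram N n k)))"
      unfolding S_eq by (intro order.trans[OF norm_sum] sum_mono norm_sum)
    also have "\<dots> \<le> E N"
      unfolding E_def by (intro sum_mono) (simp add: norm_mult mult_left_mono trunc_gram_le)
    finally show ?thesis .
  qed
  have "(\<lambda>N. E N) \<longlonglongrightarrow> (\<Sum>n\<in>F. \<Sum>k\<in>F. cmod (a n) * cmod (a k) * (gram_bound (n - k) + \<bar>0\<bar> + \<bar>0\<bar>))"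
    unfolding E_def by (intro tendsto_intros trunc_recip_tendsto)
  then have E_lim: "E \<longlonglongrightarrow> E0" by (simp add: E0_def)
  obtain N0 where N0: "M \<subseteq> {- int N0..int N0}"
  proof -
    define N0 where "N0 = nat (\<Sum>m\<in>M. \<bar>m\<bar>)"
    have "\<bar>m\<bar> \<le> int N0" if "m \<in> M" for m
      unfolding N0_def using member_le_sum[OF that, of abs] \<open>finite M\<close> by (simp add: sum_nonneg)
    then have "M \<subseteq> {- int N0..int N0}" by fastforce
    then show thesis by (rule that)
  qed
  have "(\<Sum>m\<in>M. (cmod (\<Sum>n\<in>F. a n / of_int (m - n)))\<^sup>2) \<le> E N" if "N \<ge> N0" for N
  proof -
    have "(\<Sum>m\<in>M. (cmod (\<Sum>n\<in>F. a n / of_int (m - n)))\<^sup>2) \<le> S N"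
      unfolding S_def using N0 that by (intro sum_mono2) auto
    then show ?thesis using S_le[of N] by linarith
  qed
  then have "(\<Sum>m\<in>M. (cmod (\<Sum>n\<in>F. a n / of_int (m - n)))\<^sup>2) \<le> E0"
    by (intro Lim_bounded2[OF E_lim]) blast
  also have "E0 \<le> (\<Sum>n\<in>F. \<Sum>k\<in>F. ((cmod (a n))\<^sup>2 / 2 + (cmod (a k))\<^sup>2 / 2) * gram_bound (n - k))"
  proof -
    have "0 \<le> gram_bound j" for j
      unfolding gram_bound_def inv_sq_total_def by (simp add: infsum_nonneg)
    moreover have "x * y \<le> x\<^sup>2 / 2 + y\<^sup>2 / 2" for x y :: real
      using sum_squares_bound[of x y] by simp
    ultimately show ?thesis
      unfolding E0_def by (intro sum_mono mult_right_mono) auto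
  qed
  also have "\<dots> = (\<Sum>n\<in>F. \<Sum>k\<in>F. (cmod (a n))\<^sup>2 / 2 * gram_bound (n - k))
      + (\<Sum>n\<in>F. \<Sum>k\<in>F. (cmod (a k))\<^sup>2 / 2 * gram_bound (n - k))"
    by (simp add: ring_distribs sum.distrib)
  also have "(\<Sum>n\<in>F. \<Sum>k\<in>F. (cmod (a k))\<^sup>2 / 2 * gram_bound (n - k))
      = (\<Sum>n\<in>F. \<Sum>k\<in>F. (cmod (a n))\<^sup>2 / 2 * gram_bound (n - k))"
  proof -
    have "gram_bound (n - k) = gram_bound (k - n)" for n k
      by (simp add: gram_bound_def power2_commute)
    then show ?thesis by (subst sum.swap) simp
  qed
  also have "(\<Sum>n\<in>F. \<Sum>k\<in>F. (cmod (a n))\<^sup>2 / 2 * gram_bound (n - k))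
      + (\<Sum>n\<in>F. \<Sum>k\<in>F. (cmod (a n))\<^sup>2 / 2 * gram_bound (n - k))
      = (\<Sum>n\<in>F. (cmod (a n))\<^sup>2 * (\<Sum>k\<in>F. gram_bound (n - k)))"
    unfolding sum.distrib[symmetric] sum_distrib_left by (simp add: mult.commute)
  also have "\<dots> \<le> (\<Sum>n\<in>F. (cmod (a n))\<^sup>2 * (3 * inv_sq_total))"
    using \<open>finite F\<close> by (intro sum_mono mult_left_mono gram_bound_sum_le) auto
  finally show ?thesis by (simp add: sum_distrib_left mult_ac)
qed

lemma hilbert_coeff_abs_summable:
  assumes "square_summable a"
  shows "(\<lambda>n. norm (a n / of_int (m - n))) summable_on A"
proof -
  have "(\<lambda>n. norm (a n / of_int (m - n))) summable_on UNIV"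
  proof (rule summable_on_comparison_test)
    have "(\<lambda>n. 1 / (real_of_int (m - n))\<^sup>2) summable_on UNIV"
      using inv_sq_summable
      by (subst summable_on_reindex_bij_witness[where i = "\<lambda>j. m - j" and j = "\<lambda>n. m - n"
            and T = UNIV and h = "\<lambda>j. 1 / (real_of_int j)\<^sup>2"]) auto
    then show "(\<lambda>n. (cmod (a n))\<^sup>2 + 1 / (real_of_int (m - n))\<^sup>2) summable_on UNIV"
      using assms unfolding square_summable_def by (intro summable_on_add)
    fix n
    have "norm (a n / of_int (m - n)) = cmod (a n) * \<bar>1 / real_of_int (m - n)\<bar>"
      by (simp only: norm_divide norm_of_int abs_divide) simp
    also have "\<dots> \<le> 2 * cmod (a n) * \<bar>1 / real_of_int (m - n)\<bar>"
      by (intro mult_right_mono) auto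
    also have "\<dots> \<le> (cmod (a n))\<^sup>2 + \<bar>1 / real_of_int (m - n)\<bar>\<^sup>2"
      by (rule sum_squares_bound)
    finally show "norm (a n / of_int (m - n)) \<le> (cmod (a n))\<^sup>2 + 1 / (real_of_int (m - n))\<^sup>2"
      by (simp add: power_divide)
  qed auto
  then show ?thesis using summable_on_subset_banach[of _ UNIV A] by blast
qed

definition hilbert_coeff :: "(int \<Rightarrow> complex) \<Rightarrow> int \<Rightarrow> complex" where
  "hilbert_coeff a m = (\<Sum>\<^sub>\<infinity>n\<in>UNIV - {m}. a n / of_int (m - n))"

lemma hilbert_coeff_has_sum:
  assumes "square_summable a"
  shows "((\<lambda>n. a n / of_int (m - n)) has_sum hilbert_coeff a m) UNIV"
proof -
  have "((\<lambda>n. a n / of_int (m - n)) has_sum hilbert_coeff a m) (UNIV - {m})"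
    unfolding hilbert_coeff_def
    by (rule has_sum_infsum[OF abs_summable_summable[OF hilbert_coeff_abs_summable[OF assms]]])
  then show ?thesis
    by (subst has_sum_cong_neutral[where T = "UNIV - {m}" and g = "\<lambda>n. a n / of_int (m - n)"]) auto
qed

lemma hilbert_coeff_bound:
  assumes "finite M"
  shows "(\<Sum>m\<in>M. (cmod (hilbert_coeff (ell2_nth a) m))\<^sup>2) \<le> 3 * inv_sq_total * (norm a)\<^sup>2"
proof (rule tendsto_upperbound)
  show "((\<lambda>F. \<Sum>m\<in>M. (cmod (\<Sum>n\<in>F. ell2_nth a n / of_int (m - n)))\<^sup>2) \<longlongrightarrow>
      (\<Sum>m\<in>M. (cmod (hilbert_coeff (ell2_nth a) m))\<^sup>2)) (finite_subsets_at_top UNIV)"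
    by (intro tendsto_sum tendsto_power tendsto_norm
        hilbert_coeff_has_sum[OF square_summable_ell2_nth[of a], unfolded has_sum_def])
  have pos: "0 \<le> inv_sq_total" unfolding inv_sq_total_def by (intro infsum_nonneg) auto
  have "(\<Sum>m\<in>M. (cmod (\<Sum>n\<in>F. ell2_nth a n / of_int (m - n)))\<^sup>2) \<le> 3 * inv_sq_total * (norm a)\<^sup>2"
    if "finite F" for F
  proof -
    have "3 * inv_sq_total * (\<Sum>n\<in>F. (cmod (ell2_nth a n))\<^sup>2) \<le> 3 * inv_sq_total * (norm a)\<^sup>2"
      using pos finite_sum_le_norm_ell2[OF that, of a] by (intro mult_left_mono) auto
    then show ?thesis using hilbert_finite_bound[OF that assms, of "ell2_nth a"] by linarith
  qed
  then show "\<forall>\<^sub>F F in finite_subsets_at_top UNIV.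
      (\<Sum>m\<in>M. (cmod (\<Sum>n\<in>F. ell2_nth a n / of_int (m - n)))\<^sup>2) \<le> 3 * inv_sq_total * (norm a)\<^sup>2"
    by (intro eventually_finite_subsets_at_top_weakI)
qed (rule finite_subsets_at_top_neq_bot)

lemma square_summable_hilbert_coeff:
  assumes "square_summable a"
  shows "square_summable (hilbert_coeff a)"
proof -
  have a: "ell2_nth (Abs_ell2 a) = a" using assms by (simp add: Abs_ell2_inverse)
  show ?thesis
    by (rule square_summableI[OF hilbert_coeff_bound[of _ "Abs_ell2 a", unfolded a]])
qed

lift_definition hilbert_map :: "ell2 \<Rightarrow> ell2" is hilbert_coeff
  by (rule square_summable_hilbert_coeff)

lift_definition hilbert_op :: "ell2 \<Rightarrow>\<^sub>L ell2" is hilbert_map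
proof (rule bounded_linear_intro)
  note hs = hilbert_coeff_has_sum[OF square_summable_ell2_nth]
  fix a b :: ell2 and r :: real
  show "hilbert_map (a + b) = hilbert_map a + hilbert_map b"
  proof (rule ell2_eqI)
    fix m
    have "((\<lambda>n. ell2_nth (a + b) n / of_int (m - n)) has_sum
        (hilbert_coeff (ell2_nth a) m + hilbert_coeff (ell2_nth b) m)) UNIV"
      using has_sum_add[OF hs[of a m] hs[of b m]]
      by (simp add: plus_ell2.rep_eq add_divide_distrib)
    from has_sum_unique[OF hs this]
    show "ell2_nth (hilbert_map (a + b)) m = ell2_nth (hilbert_map a + hilbert_map b) m"
      by (simp add: hilbert_map.rep_eq plus_ell2.rep_eq)
  qed
  show "hilbert_map (r *\<^sub>R a) = r *\<^sub>R hilbert_map a"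
  proof (rule ell2_eqI)
    fix m
    have "((\<lambda>n. ell2_nth (r *\<^sub>R a) n / of_int (m - n)) has_sum
        (r *\<^sub>R hilbert_coeff (ell2_nth a) m)) UNIV"
      using has_sum_scaleR[OF hs[of a m], of r]
      by (simp add: scaleR_ell2.rep_eq scaleR_conv_of_real)
    from has_sum_unique[OF hs this]
    show "ell2_nth (hilbert_map (r *\<^sub>R a)) m = ell2_nth (r *\<^sub>R hilbert_map a) m"
      by (simp add: hilbert_map.rep_eq scaleR_ell2.rep_eq)
  qed
  have "(norm (hilbert_map a))\<^sup>2 \<le> 3 * inv_sq_total * (norm a)\<^sup>2"
    by (rule norm_ell2_sq_leI) (simp add: hilbert_map.rep_eq hilbert_coeff_bound)
  then have "norm (hilbert_map a) \<le> sqrt (3 * inv_sq_total * (norm a)\<^sup>2)"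
    by (rule real_le_rsqrt)
  then show "norm (hilbert_map a) \<le> norm a * sqrt (3 * inv_sq_total)"
    by (simp add: real_sqrt_mult mult_ac)
qed

lemma hilbert_op_nth:
  "ell2_nth (hilbert_op a) m = (\<Sum>\<^sub>\<infinity>n\<in>UNIV - {m}. ell2_nth a n / of_int (m - n))"
  by (simp add: hilbert_op.rep_eq hilbert_map.rep_eq hilbert_coeff_def)

definition blinfun_pow :: "('a::real_normed_vector \<Rightarrow>\<^sub>L 'a) \<Rightarrow> nat \<Rightarrow> 'a \<Rightarrow>\<^sub>L 'a" where
  "blinfun_pow T k = ((\<lambda>S. T o\<^sub>L S) ^^ k) id_blinfun"

text \<open>The exponential of \<open>t T\<close>; the series is taken in the operator norm.
  (\<open>exp\<close> itself is unavailable, since operators on \<open>'a\<close> do not form a \<open>real_normed_algebra_1\<close>.)\<close>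

definition blinfun_exp :: "real \<Rightarrow> ('a::banach \<Rightarrow>\<^sub>L 'a) \<Rightarrow> 'a \<Rightarrow>\<^sub>L 'a" where
  "blinfun_exp t T = (\<Sum>k. (t ^ k / fact k) *\<^sub>R blinfun_pow T k)"

lemma summable_blinfun_exp:
  fixes T :: "'a::banach \<Rightarrow>\<^sub>L 'a"
  shows "summable (\<lambda>k. (t ^ k / fact k) *\<^sub>R blinfun_pow T k)"
proof (rule summable_comparison_test')
  have pow: "norm (blinfun_pow T k) \<le> norm T ^ k" for k
  proof (induction k)
    case 0
    show ?case
      unfolding blinfun_pow_def by (auto intro!: norm_blinfun_bound)
  next
    case (Suc k)
    have "norm (T o\<^sub>L blinfun_pow T k) \<le> norm T * norm (blinfun_pow T k)"
      by (rule norm_blinfun_compose)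
    also have "\<dots> \<le> norm T * norm T ^ k"
      by (intro mult_left_mono Suc) simp
    finally show ?case by (simp add: blinfun_pow_def)
  qed
  show "summable (\<lambda>k. (\<bar>t\<bar> * norm T) ^ k /\<^sub>R fact k)"
    by (rule summable_exp_generic)
  fix k
  have "norm ((t ^ k / fact k) *\<^sub>R blinfun_pow T k) = \<bar>t\<bar> ^ k / fact k * norm (blinfun_pow T k)"
    by (simp add: power_abs)
  also have "\<dots> \<le> \<bar>t\<bar> ^ k / fact k * norm T ^ k"
    by (intro mult_left_mono pow) simp
  also have "\<dots> = (\<bar>t\<bar> * norm T) ^ k /\<^sub>R fact k"
    by (simp add: power_mult_distrib divide_inverse mult_ac)
  finally show "norm ((t ^ k / fact k) *\<^sub>R blinfun_pow T k) \<le> (\<bar>t\<bar> * norm T) ^ k /\<^sub>R fact k" .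
qed

text \<open>The normalised cardinal sine, as opposed to \<open>sin t / t\<close>.\<close>

definition nsinc :: "real \<Rightarrow> real" where
  "nsinc t = (if t = 0 then 1 else sin (pi * t) / (pi * t))"

end

theory Submission
  imports Defs
begin

text \<open>
  The operators \<open>exp (t H)\<close> can be written down explicitly. Under Fourier series \<open>H\<close> becomes multiplication
  by \<open>i (\<pi> - \<theta>)\<close> on \<open>(0, 2\<pi>)\<close>, so \<open>exp (t H)\<close> should be convolution with the Fourier coefficients of
  \<open>exp (i t (\<pi> - \<theta>))\<close>, which are \<open>(-1)^j nsinc (t + j)\<close>. For \<open>t\<close> outside \<open>\<int>\<close> this is
  \<open>sin (\<pi> t) / (\<pi> (t + j))\<close>, and at an integer \<open>k\<close> the operator is the signed shift
  \<open>a \<mapsto> (\<lambda>m. (-1)^k a (m + k))\<close>.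

  Fourier series serve only to guess this kernel. That it is right is a matter of the differential
  equation \<open>d/dt (exp (t H)) = H exp (t H)\<close>, which for the kernel says that its discrete Hilbert transform is
  its derivative in \<open>t\<close> (\<open>hilbert_kernel_transform\<close>). This is the partial fraction expansion of the
  cotangent (\<open>cot_partial_fractions\<close>), a consequence of the reflection formula of the Gamma function. The
  equation holds coordinate by coordinate, and \<open>blinfun_exp_eqI\<close> shows that this suffices for a locally
  bounded curve in \<open>ell2\<close>. Linearity and continuity carry the kernel formula from unit vectors to all of
  \<open>ell2\<close> (\<open>blinfun_exp_hilbert_nth\<close>).

  The sampling series converges absolutely, because the \<open>exp (k H)\<close> are isometries and
  \<open>nsinc (t - k) / k\<close> is summable over \<open>k\<close>. Its sum can therefore be computed in each coordinate, where
  the signed shifts turn it into a scalar series: partial fractions split the coefficient of \<open>a (m + k)\<close>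
  into the kernels of \<open>exp (t H)\<close> and of \<open>H\<close>, and the total coefficient of \<open>a m\<close> is the partial fraction expansion of
  the cosecant (\<open>sampling_series_nth\<close>). At an integer \<open>t\<close> at most one term of the series survives.
\<close>

section \<open>The cardinal sine at the points of a shifted lattice\<close>

lemma nsinc_abs_le_one: "\<bar>nsinc x\<bar> \<le> 1"
  using abs_sin_x_le_abs_x[of "pi * x"] by (simp add: nsinc_def abs_divide divide_le_eq_1)

lemma nsinc_sq_le_recip_sq: "(nsinc x)\<^sup>2 \<le> 1 / x\<^sup>2" if "x \<noteq> 0"
proof -
  have "\<bar>nsinc x\<bar> = \<bar>sin (pi * x)\<bar> / (pi * \<bar>x\<bar>)"
    using that by (simp add: nsinc_def abs_divide abs_mult)
  also have "\<dots> \<le> 1 / (1 * \<bar>x\<bar>)"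
    using that pi_ge_two by (intro frac_le mult_right_mono) auto
  finally have "\<bar>nsinc x\<bar>\<^sup>2 \<le> (1 / \<bar>x\<bar>)\<^sup>2" by (intro power_mono) auto
  then show ?thesis by (simp add: power_divide)
qed

lemma nsinc_sq_shift_le:
  fixes N :: nat
  assumes "\<bar>t\<bar> \<le> real N"
  shows "(nsinc (t + of_int j))\<^sup>2 \<le> (if j \<in> {- int (2 * N)..int (2 * N)} then 1 else 0) + 4 * (1 / (of_int j)\<^sup>2)"
proof (cases "j \<in> {- int (2 * N)..int (2 * N)}")
  case True
  have "\<bar>nsinc (t + of_int j)\<bar>\<^sup>2 \<le> 1\<^sup>2"
    by (intro power_mono nsinc_abs_le_one) auto
  then show ?thesis using True by (simp add: add_increasing2)
next
  case False
  then have "2 * real N < \<bar>real_of_int j\<bar>" by auto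
  then have half: "\<bar>real_of_int j\<bar> / 2 \<le> \<bar>t + of_int j\<bar>" using assms by linarith
  have j: "j \<noteq> 0" using False by auto
  then have tj: "t + of_int j \<noteq> 0" using half by auto
  have "(\<bar>real_of_int j\<bar> / 2)\<^sup>2 \<le> \<bar>t + of_int j\<bar>\<^sup>2"
    using half by (intro power_mono) auto
  then have "1 / (t + of_int j)\<^sup>2 \<le> 1 / (\<bar>real_of_int j\<bar> / 2)\<^sup>2"
    using j tj by (intro divide_left_mono) auto
  then show ?thesis
    using tj nsinc_sq_le_recip_sq[of "t + of_int j"] False by (auto simp: power_divide)
qed

text \<open>The bound is uniform for \<open>t\<close> in \<open>[-N, N]\<close>: the at most \<open>4N + 1\<close> samples with \<open>\<bar>j\<bar> \<le> 2N\<close> are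
  bounded by 1, and beyond that range \<open>\<bar>t + j\<bar> \<ge> \<bar>j\<bar> / 2\<close>. Uniformity is what makes the orbit of the
  kernel a locally bounded curve in \<open>ell2\<close>.\<close>

lemma nsinc_sq_sum_le:
  assumes "\<bar>t\<bar> \<le> real N" "finite F"
  shows "(\<Sum>j\<in>F. (nsinc (t + of_int j))\<^sup>2) \<le> 4 * real N + 1 + 4 * inv_sq_total"
proof -
  let ?I = "{- int (2 * N)..int (2 * N)}"
  have "(\<Sum>j\<in>F. (nsinc (t + of_int j))\<^sup>2) \<le>
     (\<Sum>j\<in>F. (if j \<in> ?I then 1 else 0) + 4 * (1 / (real_of_int j)\<^sup>2))"
    by (intro sum_mono nsinc_sq_shift_le assms)
  also have "\<dots> = real (card (F \<inter> ?I)) + 4 * (\<Sum>j\<in>F. 1 / (real_of_int j)\<^sup>2)"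
    unfolding sum.distrib sum_distrib_left[symmetric] using assms(2)
    by (simp only: sum.inter_restrict[symmetric]) simp
  also have "card (F \<inter> ?I) \<le> card ?I" by (intro card_mono) auto
  also have "(\<Sum>j\<in>F. 1 / (real_of_int j)\<^sup>2) \<le> inv_sq_total"
    using inv_sq_finite_le[of F "\<lambda>j. j"] assms(2) by simp
  finally show ?thesis by simp
qed

lemma nsinc_sq_summable: "(\<lambda>j::int. (nsinc (t + of_int j))\<^sup>2) summable_on UNIV"
proof (rule nonneg_bdd_above_summable_on)
  obtain N :: nat where "\<bar>t\<bar> \<le> real N" using real_arch_simple by blast
  then show "bdd_above (sum (\<lambda>j. (nsinc (t + real_of_int j))\<^sup>2) ` {F. F \<subseteq> UNIV \<and> finite F})"
    by (auto intro!: bdd_aboveI nsinc_sq_sum_le)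
qed auto

text \<open>These are the scalar weights of the sampling series, so their absolute summability gives its
  convergence in norm. The term \<open>k = 0\<close> is zero because division by zero is.\<close>

lemma nsinc_over_summable:
  "(\<lambda>k::int. \<bar>nsinc (t - of_int k) / of_int k\<bar>) summable_on UNIV"
proof (rule summable_on_comparison_test)
  have "(\<lambda>k::int. (nsinc (t - of_int k))\<^sup>2) summable_on UNIV"
    using nsinc_sq_summable[of t]
    by (subst summable_on_reindex_bij_witness[where i = uminus and j = uminus and T = UNIV
          and h = "\<lambda>j. (nsinc (t + of_int j))\<^sup>2"]) auto
  then show "(\<lambda>k::int. (nsinc (t - of_int k))\<^sup>2 + 1 / (of_int k)\<^sup>2) summable_on UNIV"
    using inv_sq_summable by (rule summable_on_add)
  fix k :: int
  have "\<bar>nsinc (t - of_int k) / of_int k\<bar> \<le> 2 * \<bar>nsinc (t - of_int k)\<bar> * \<bar>1 / of_int k\<bar>"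
    unfolding abs_divide by (simp add: divide_right_mono)
  also have "\<dots> \<le> \<bar>nsinc (t - of_int k)\<bar>\<^sup>2 + \<bar>1 / real_of_int k\<bar>\<^sup>2"
    by (rule sum_squares_bound)
  finally show "\<bar>nsinc (t - of_int k) / of_int k\<bar> \<le> (nsinc (t - of_int k))\<^sup>2 + 1 / (of_int k)\<^sup>2"
    by (simp add: power_divide)
qed auto

lemma sin_pi_add_int: "sin (pi * (t + of_int j)) = sin (pi * t) * cos (pi * of_int j)"
  by (simp add: distrib_left sin_add)

lemma cos_pi_int_sq: "cos (pi * of_int j) * cos (pi * of_int j) = (1::real)"
  using sin_cos_squared_add[of "pi * of_int j"] by (simp add: power2_eq_square)

lemma sin_pi_eq_0_iff: "sin (pi * x) = 0 \<longleftrightarrow> x \<in> \<int>"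
  by (auto simp: sin_zero_iff_int2 Ints_def)

lemma nsinc_diff_int:
  assumes "t \<notin> \<int>"
  shows "nsinc (t - of_int k) = cos (pi * of_int k) * sin (pi * t) / (pi * (t - of_int k))"
  using sin_pi_add_int[of t "- k"] assms by (auto simp: nsinc_def)

lemma nsinc_of_int: "nsinc (of_int k) = (if k = 0 then 1 else 0)"
  by (simp add: nsinc_def)

text \<open>The value at the origin is 0 because \<^const>\<open>nsinc\<close> is even.\<close>

definition nsinc_deriv :: "real \<Rightarrow> real" where
  "nsinc_deriv x = (if x = 0 then 0 else (cos (pi * x) - nsinc x) / x)"

lemma has_real_derivative_nsinc: "(nsinc has_real_derivative nsinc_deriv x) (at x)"
proof (cases "x = 0")
  case True
  have bound: "norm ((nsinc (0 + h) - nsinc 0) / h) \<le> pi\<^sup>2 * \<bar>h\<bar>" if "h \<noteq> 0" for h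
  proof -
    have "(\<Sum>m<3. sin_coeff m * (pi * h) ^ m) = pi * h"
      by (simp add: numeral_3_eq_3 sin_coeff_def)
    then have "\<bar>sin (pi * h) - pi * h\<bar> \<le> inverse (fact 3) * \<bar>pi * h\<bar> ^ 3"
      using Maclaurin_sin_bound[of "pi * h" 3] by simp
    also have "\<dots> \<le> 1 * \<bar>pi * h\<bar> ^ 3"
      by (intro mult_right_mono) (auto simp: fact_numeral)
    finally have "\<bar>sin (pi * h) - pi * h\<bar> / (pi * \<bar>h\<bar> * \<bar>h\<bar>) \<le> \<bar>pi * h\<bar> ^ 3 / (pi * \<bar>h\<bar> * \<bar>h\<bar>)"
      by (intro divide_right_mono) auto
    also have "\<dots> = pi\<^sup>2 * \<bar>h\<bar>"
      using that by (simp add: field_simps abs_mult power2_eq_square power3_eq_cube)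
    also have "\<bar>sin (pi * h) - pi * h\<bar> / (pi * \<bar>h\<bar> * \<bar>h\<bar>) = norm ((nsinc (0 + h) - nsinc 0) / h)"
    proof -
      have "(nsinc (0 + h) - nsinc 0) / h = (sin (pi * h) - pi * h) / (pi * h * h)"
        using that by (simp add: nsinc_def field_simps)
      then show ?thesis by (simp add: abs_mult)
    qed
    finally show ?thesis .
  qed
  have "((\<lambda>h. (nsinc (0 + h) - nsinc 0) / h) \<longlongrightarrow> 0) (at 0)"
  proof (rule Lim_null_comparison)
    show "\<forall>\<^sub>F h in at 0. norm ((nsinc (0 + h) - nsinc 0) / h) \<le> pi\<^sup>2 * \<bar>h\<bar>"
      using bound by (auto simp: eventually_at_filter)
    show "((\<lambda>h. pi\<^sup>2 * \<bar>h\<bar>) \<longlongrightarrow> 0) (at (0::real))" by (auto intro!: tendsto_eq_intros)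
  qed
  then show ?thesis using True by (simp add: DERIV_def nsinc_deriv_def)
next
  case False
  have "((\<lambda>y. sin (pi * y) / (pi * y)) has_real_derivative
      (cos (pi * x) * pi * (pi * x) - sin (pi * x) * pi) / (pi * x * (pi * x))) (at x)"
    using False by (auto intro!: derivative_eq_intros)
  moreover have "(cos (pi * x) * pi * (pi * x) - sin (pi * x) * pi) / (pi * x * (pi * x)) = nsinc_deriv x"
    using False by (simp add: nsinc_deriv_def nsinc_def field_simps)
  moreover have "\<forall>\<^sub>F y in nhds x. sin (pi * y) / (pi * y) = nsinc y"
    using False eventually_nhds_in_open[of "- {0}" x]
    by (auto simp: nsinc_def elim!: eventually_mono)
  ultimately show ?thesis by (subst (asm) DERIV_cong_ev) auto
qed

section \<open>Partial fractions of the cotangent and the cosecant\<close>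

text \<open>Both sides arise on differentiating Euler's reflection formula \<open>\<Gamma>(z) \<Gamma>(1 - z) = \<pi> / sin (\<pi> z)\<close>, used in
  its reciprocal form, which has no poles.\<close>

lemma Digamma_reflection_real:
  fixes x :: real
  assumes "x \<notin> \<int>"
  shows "Digamma (1 - x) - Digamma x = pi * cot (pi * x)"
proof -
  define z where "z = complex_of_real x"
  have "z \<notin> \<int>"
    using assms by (auto simp: z_def complex_is_Int_iff)
  then have z: "z \<notin> \<int>" "1 - z \<notin> \<int>"
    using Ints_diff[OF Ints_1, of "1 - z"] by auto
  have x0: "x \<noteq> 0" "1 - x \<noteq> 0" using assms by auto
  from z have nonpos: "z \<notin> \<int>\<^sub>\<le>\<^sub>0" "1 - z \<notin> \<int>\<^sub>\<le>\<^sub>0"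
    using nonpos_Ints_subset_Ints by auto
  have eq: "rGamma w * rGamma (1 - w) = sin (of_real pi * w) / of_real pi" for w :: complex
    by (rule rGamma_reflection_complex)
  have "((\<lambda>w. rGamma w * rGamma (1 - w)) has_field_derivative
      (rGamma z * rGamma (1 - z) * (Digamma (1 - z) - Digamma z))) (at z)"
    using nonpos by (auto intro!: derivative_eq_intros simp: algebra_simps)
  moreover have "((\<lambda>w. rGamma w * rGamma (1 - w)) has_field_derivative cos (of_real pi * z)) (at z)"
    unfolding eq by (auto intro!: derivative_eq_intros)
  ultimately have "sin (of_real pi * z) / of_real pi * (Digamma (1 - z) - Digamma z) = cos (of_real pi * z)"
    unfolding eq by (rule DERIV_unique)
  moreover have "Digamma (1 - z) - Digamma z = of_real (Digamma (1 - x) - Digamma x)"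
    using Polygamma_of_real[where 'a = complex, OF x0(1), of 0]
      Polygamma_of_real[where 'a = complex, OF x0(2), of 0] by (simp add: z_def)
  ultimately have "complex_of_real (sin (pi * x) / pi * (Digamma (1 - x) - Digamma x)) = of_real (cos (pi * x))"
    by (simp only: z_def of_real_mult[symmetric] of_real_divide[symmetric] sin_of_real cos_of_real)
  then have "sin (pi * x) / pi * (Digamma (1 - x) - Digamma x) = cos (pi * x)"
    by (simp only: of_real_eq_iff)
  moreover have "sin (pi * x) \<noteq> 0"
    using assms by (auto simp: sin_zero_iff_int2 Ints_def)
  ultimately show ?thesis by (simp add: cot_def field_simps)
qed

lemma filterlim_symmetric_intervals:
  "filterlim (\<lambda>N. {- int N..int N}) (finite_subsets_at_top UNIV) sequentially"
  unfolding filterlim_iff eventually_finite_subsets_at_top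
proof safe
  fix P :: "int set \<Rightarrow> bool" and X :: "int set"
  assume X: "finite X" and P: "\<forall>Y. finite Y \<and> X \<subseteq> Y \<and> Y \<subseteq> UNIV \<longrightarrow> P Y"
  define N0 where "N0 = nat (\<Sum>m\<in>X. \<bar>m\<bar>)"
  have "\<bar>m\<bar> \<le> int N0" if "m \<in> X" for m
    unfolding N0_def using member_le_sum[OF that, of abs] X by (simp add: sum_nonneg)
  then have "X \<subseteq> {- int N..int N}" if "N \<ge> N0" for N using that by fastforce
  then have "P {- int N..int N}" if "N \<ge> N0" for N using P that by simp
  then show "\<forall>\<^sub>F N in sequentially. P {- int N..int N}"
    by (rule eventually_sequentiallyI)
qed

text \<open>An unconditionally convergent sum over \<open>\<int>\<close> may be evaluated along any exhausting sequence of
  finite sets; the symmetric intervals are the ones along which odd terms cancel.\<close>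

lemma has_sum_int_symmetric:
  fixes f :: "int \<Rightarrow> 'a :: {t2_space, comm_monoid_add}"
  assumes "f summable_on UNIV" "(\<lambda>N. \<Sum>i\<in>{- int N..int N}. f i) \<longlonglongrightarrow> S"
  shows "(f has_sum S) UNIV"
proof -
  obtain T where T: "(f has_sum T) UNIV" using assms(1) by (auto simp: summable_on_def)
  then have "(\<lambda>N. \<Sum>i\<in>{- int N..int N}. f i) \<longlonglongrightarrow> T"
    unfolding has_sum_def by (rule filterlim_compose[OF _ filterlim_symmetric_intervals])
  then have "T = S" using assms(2) by (rule LIMSEQ_unique)
  then show ?thesis using T by simp
qed

lemma sum_recip_shift_symmetric:
  fixes x :: real
  shows "(\<Sum>i\<in>{- int N..int N}. 1 / (x - of_int i)) =
     (\<Sum>n<Suc N. inverse (x + of_nat n)) - (\<Sum>n<N. inverse ((1 - x) + of_nat n))"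
proof (induction N)
  case (Suc N)
  have "{- int (Suc N)..int (Suc N)} = insert (- int (Suc N)) (insert (int (Suc N)) {- int N..int N})"
    by auto
  moreover have "1 / (x - real_of_int (int (Suc N))) = - inverse ((1 - x) + of_nat N)"
  proof -
    have "x - real_of_int (int (Suc N)) = - ((1 - x) + of_nat N)" by simp
    then show ?thesis by (simp only: divide_inverse inverse_minus_eq)
  qed
  ultimately show ?case using Suc by (simp add: inverse_eq_divide)
qed (simp add: inverse_eq_divide)

text \<open>For \<open>i \<noteq> 0\<close> the summand is \<open>(1/i + 1/(x - i)) / x\<close>. Over a symmetric range the terms \<open>1/i\<close> cancel, and the
  terms \<open>1/(x - i)\<close> form two truncated digamma series, at \<open>x\<close> and at \<open>1 - x\<close>, whose logarithmic
  counterterms cancel in the limit. The product form of the summand, rather than the principal value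
  \<open>\<Sum> 1/(x - i)\<close>, is the one that converges absolutely and that the Hilbert transform produces.\<close>

lemma cot_partial_fractions:
  fixes x :: real
  assumes "x \<notin> \<int>"
  shows "((\<lambda>i::int. 1 / (of_int i * (x - of_int i))) has_sum (pi * cot (pi * x) / x - 1 / x\<^sup>2)) UNIV"
proof (rule has_sum_int_symmetric)
  have x0: "x \<noteq> 0" "1 - x \<noteq> 0" and xi: "x - of_int i \<noteq> 0" for i :: int
    using assms by auto
  show "(\<lambda>i::int. 1 / (of_int i * (x - of_int i))) summable_on UNIV"
  proof (rule abs_summable_summable, rule summable_on_comparison_test)
    show "(\<lambda>i::int. pi / \<bar>sin (pi * x)\<bar> * \<bar>nsinc (x - of_int i) / of_int i\<bar>) summable_on UNIV"
      by (intro summable_on_cmult_right nsinc_over_summable)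
    fix i :: int
    have "\<bar>cos (pi * of_int i)\<bar> = 1"
      using cos_pi_int_sq[of i] by (simp flip: power2_eq_square abs_square_eq_1)
    then show "norm (1 / (of_int i * (x - of_int i))) \<le> pi / \<bar>sin (pi * x)\<bar> * \<bar>nsinc (x - of_int i) / of_int i\<bar>"
      using assms by (simp add: nsinc_diff_int abs_mult sin_pi_eq_0_iff mult_ac)
  qed auto
  (* The subtracted term accounts for i = 0, where the left-hand side is 0 by division by zero. *)
  have part: "1 / (of_int i * (x - of_int i)) =
      1 / x * (1 / of_int (i - 0) + 1 / (x - of_int i) - (if i = 0 then 1 / x else 0))" for i :: int
    using x0 xi[of i] by (auto simp: field_simps)
  have "(\<Sum>i\<in>{- int N..int N}. 1 / (of_int i * (x - of_int i))) =
      1 / x * (((\<Sum>n<Suc N. inverse (x + of_nat n)) - (\<Sum>n<N. inverse ((1 - x) + of_nat n))) - 1 / x)"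
    for N
    unfolding part sum_recip_shift_symmetric[symmetric] sum_distrib_left[symmetric]
    using trunc_recip_0[of N]
    by (simp add: sum.distrib sum_subtractf trunc_recip_def)
  moreover have "(\<lambda>N. 1 / x * (((\<Sum>n<Suc N. inverse (x + of_nat n)) - (\<Sum>n<N. inverse ((1 - x) + of_nat n))) - 1 / x))
     \<longlonglongrightarrow> 1 / x * (Digamma (1 - x) - Digamma x - 1 / x)"
  proof -
    have "(\<lambda>N. (ln (real N) - (\<Sum>n<N. inverse ((1 - x) + of_nat n)))
        - (ln (real (Suc N)) - (\<Sum>n<Suc N. inverse (x + of_nat n)))
        - ln (real N / real (Suc N))) \<longlonglongrightarrow> Digamma (1 - x) - Digamma x - ln 1"
    proof (intro tendsto_intros)
      show "(\<lambda>N. ln (real N) - (\<Sum>n<N. inverse ((1 - x) + of_nat n))) \<longlonglongrightarrow> Digamma (1 - x)"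
        using Digamma_LIMSEQ[OF x0(2)] by simp
      show "(\<lambda>N. ln (real (Suc N)) - (\<Sum>n<Suc N. inverse (x + of_nat n))) \<longlonglongrightarrow> Digamma x"
        using LIMSEQ_Suc[OF Digamma_LIMSEQ[OF x0(1)]] by simp
      show "(\<lambda>N. real N / real (Suc N)) \<longlonglongrightarrow> 1" by (rule LIMSEQ_n_over_Suc_n)
    qed auto
    moreover have "\<forall>\<^sub>F N in sequentially.
       (ln (real N) - (\<Sum>n<N. inverse ((1 - x) + of_nat n)))
        - (ln (real (Suc N)) - (\<Sum>n<Suc N. inverse (x + of_nat n)))
        - ln (real N / real (Suc N)) =
       (\<Sum>n<Suc N. inverse (x + of_nat n)) - (\<Sum>n<N. inverse ((1 - x) + of_nat n))"
      using eventually_gt_at_top[of 0] by eventually_elim (simp add: ln_div)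
    ultimately have "(\<lambda>N. (\<Sum>n<Suc N. inverse (x + of_nat n)) - (\<Sum>n<N. inverse ((1 - x) + of_nat n)))
        \<longlonglongrightarrow> Digamma (1 - x) - Digamma x"
      using Lim_transform_eventually by fastforce
    then show ?thesis by (intro tendsto_mult tendsto_diff[OF _ tendsto_const] tendsto_const)
  qed
  ultimately have "(\<lambda>N. \<Sum>i\<in>{- int N..int N}. 1 / (of_int i * (x - of_int i)))
      \<longlonglongrightarrow> 1 / x * (Digamma (1 - x) - Digamma x - 1 / x)"
    by (simp only:)
  also have "1 / x * (Digamma (1 - x) - Digamma x - 1 / x) = pi * cot (pi * x) / x - 1 / x\<^sup>2"
    using Digamma_reflection_real[OF assms] x0 by (simp add: field_simps power2_eq_square)
  finally show "(\<lambda>N. \<Sum>i\<in>{- int N..int N}. 1 / (of_int i * (x - of_int i)))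
      \<longlonglongrightarrow> pi * cot (pi * x) / x - 1 / x\<^sup>2" .
qed

text \<open>The alternating sign is twice the indicator of the even integers minus one, and the even terms
  are the cotangent series at \<open>x / 2\<close>. The identity \<open>cot (y/2) - cot y = 1 / sin y\<close> then finishes.\<close>

lemma cosec_partial_fractions:
  fixes x :: real
  assumes "x \<notin> \<int>"
  shows "((\<lambda>i::int. cos (pi * of_int i) / (of_int i * (x - of_int i))) has_sum
           (pi / (x * sin (pi * x)) - 1 / x\<^sup>2)) UNIV"
proof -
  define f where "f i = 1 / (real_of_int i * (x - of_int i))" for i :: int
  have half: "x / 2 \<notin> \<int>"
  proof
    assume "x / 2 \<in> \<int>"
    then have "2 * (x / 2) \<in> \<int>" by (intro Ints_mult) auto
    then show False using assms by simp
  qed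
  have "((\<lambda>l::int. 1 / 4 * (1 / (of_int l * (x / 2 - of_int l)))) has_sum
      (1 / 4 * (pi * cot (pi * (x / 2)) / (x / 2) - 1 / (x / 2)\<^sup>2))) UNIV"
    by (intro has_sum_cmult_right cot_partial_fractions half)
  also have "(\<lambda>l::int. 1 / 4 * (1 / (of_int l * (x / 2 - of_int l)))) = f \<circ> (\<lambda>l. 2 * l)"
    by (simp add: f_def fun_eq_iff field_simps)
  finally have "(f has_sum (1 / 4 * (pi * cot (pi * (x / 2)) / (x / 2) - 1 / (x / 2)\<^sup>2)))
      (range (\<lambda>l. 2 * l))"
    by (subst has_sum_reindex) (auto simp: inj_on_def o_def)
  then have "((\<lambda>i. if even i then f i else 0) has_sum
      (1 / 4 * (pi * cot (pi * (x / 2)) / (x / 2) - 1 / (x / 2)\<^sup>2))) UNIV"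
    by (subst has_sum_cong_neutral[where T = "range (\<lambda>l. 2 * l)" and g = f]) auto
  from has_sum_add[OF has_sum_cmult_right[OF this, of 2]
      has_sum_cmult_right[OF cot_partial_fractions[OF assms, folded f_def], of "- 1"]]
  have "((\<lambda>i. 2 * (if even i then f i else 0) - f i) has_sum
      (2 * (1 / 4 * (pi * cot (pi * (x / 2)) / (x / 2) - 1 / (x / 2)\<^sup>2)) - (pi * cot (pi * x) / x - 1 / x\<^sup>2))) UNIV"
    by (simp only: mult_minus1 diff_conv_add_uminus)
  also have "(\<lambda>i. 2 * (if even i then f i else 0) - f i) =
      (\<lambda>i. cos (pi * of_int i) / (of_int i * (x - of_int i)))"
    by (auto simp: f_def fun_eq_iff)
  also have "2 * (1 / 4 * (pi * cot (pi * (x / 2)) / (x / 2) - 1 / (x / 2)\<^sup>2)) - (pi * cot (pi * x) / x - 1 / x\<^sup>2)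
      = pi / x * (cot (pi * (x / 2)) - cot (pi * x)) - 1 / x\<^sup>2"
  proof -
    have "x \<noteq> 0" using assms by auto
    then show ?thesis by (simp add: field_simps power2_eq_square)
  qed
  also have "cot (pi * (x / 2)) - cot (pi * x) = 1 / sin (pi * x)"
  proof -
    define s c where "s = sin (pi * (x / 2))" and "c = cos (pi * (x / 2))"
    have sin: "sin (pi * x) = 2 * s * c" and cos: "cos (pi * x) = 2 * c\<^sup>2 - 1"
      using sin_double[of "pi * (x / 2)"] cos_double_cos[of "pi * (x / 2)"] by (simp_all add: s_def c_def)
    have "sin (pi * x) \<noteq> 0" using assms by (simp add: sin_pi_eq_0_iff)
    then have "s \<noteq> 0" "c \<noteq> 0" unfolding sin by auto
    then show ?thesis
      unfolding cot_def sin cos s_def[symmetric] c_def[symmetric]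
      by (simp add: field_simps power2_eq_square)
  qed
  finally show ?thesis by simp
qed

section \<open>The kernel and its discrete Hilbert transform\<close>

text \<open>The convolution kernel of \<open>exp (t H)\<close>: the operator \<open>H\<close> has the symbol \<open>i (\<pi> - \<theta>)\<close> on \<open>(0, 2\<pi>)\<close>, and this
  is the \<open>j\<close>-th Fourier coefficient of \<open>exp (i t (\<pi> - \<theta>))\<close>. The factor \<open>cos (\<pi> j)\<close> is the sign \<open>(-1)^j\<close>.\<close>

definition hilbert_kernel :: "real \<Rightarrow> int \<Rightarrow> real" where
  "hilbert_kernel t j = cos (pi * of_int j) * nsinc (t + of_int j)"

definition hilbert_kernel_deriv :: "real \<Rightarrow> int \<Rightarrow> real" where
  "hilbert_kernel_deriv t j = cos (pi * of_int j) * nsinc_deriv (t + of_int j)"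

lemma has_real_derivative_hilbert_kernel:
  "((\<lambda>t. hilbert_kernel t j) has_real_derivative hilbert_kernel_deriv t j) (at t)"
proof -
  have "((\<lambda>t. nsinc (t + of_int j)) has_real_derivative nsinc_deriv (t + of_int j) * 1) (at t)"
    by (rule DERIV_chain2[OF has_real_derivative_nsinc]) (auto intro!: derivative_eq_intros)
  from DERIV_cmult[OF this] show ?thesis
    unfolding hilbert_kernel_def hilbert_kernel_deriv_def by simp
qed

lemma hilbert_kernel_nonint:
  assumes "t \<notin> \<int>"
  shows "hilbert_kernel t j = sin (pi * t) / (pi * (t + of_int j))"
proof -
  have "t + of_int j \<noteq> 0"
    using assms by (metis Ints_minus Ints_of_int eq_neg_iff_add_eq_0)
  then have "hilbert_kernel t j = (cos (pi * of_int j) * cos (pi * of_int j)) * sin (pi * t) / (pi * (t + of_int j))"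
    unfolding hilbert_kernel_def nsinc_def sin_pi_add_int by simp
  then show ?thesis unfolding cos_pi_int_sq by simp
qed

text \<open>At integer times the kernel is a signed unit mass, so that \<open>exp (k H)\<close> is a signed shift.\<close>

lemma hilbert_kernel_int:
  "hilbert_kernel (of_int k) j = (if j = - k then cos (pi * of_int k) else 0)"
  unfolding hilbert_kernel_def of_int_add[symmetric] nsinc_of_int by auto

text \<open>This is the differential equation of the group: the discrete Hilbert transform of the kernel is its
  time derivative. For \<open>t\<close> outside \<open>\<int>\<close> the transform is the cotangent series at \<open>x = t + p\<close>; at an integer
  time at most one term is nonzero.\<close>

lemma hilbert_kernel_transform:
  "((\<lambda>j. hilbert_kernel t j / of_int (p - j)) has_sum hilbert_kernel_deriv t p) UNIV"
proof (cases "t \<in> \<int>")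
  case False
  define x where "x = t + of_int p"
  have x: "x \<notin> \<int>"
    using False Ints_diff[of x "of_int p"] by (auto simp: x_def)
  then have x0: "x \<noteq> 0" and sx: "sin (pi * x) \<noteq> 0" by (auto simp: sin_pi_eq_0_iff)
  have "((\<lambda>i::int. sin (pi * t) / pi * (1 / (of_int i * (x - of_int i)))) has_sum
       (sin (pi * t) / pi * (pi * cot (pi * x) / x - 1 / x\<^sup>2))) UNIV"
    by (intro has_sum_cmult_right cot_partial_fractions x)
  also have "?this \<longleftrightarrow> ((\<lambda>j. hilbert_kernel t j / of_int (p - j)) has_sum
       (sin (pi * t) / pi * (pi * cot (pi * x) / x - 1 / x\<^sup>2))) UNIV"
    by (rule has_sum_reindex_bij_witness[where i = "\<lambda>j. p - j" and j = "\<lambda>i. p - i"])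
       (auto simp: hilbert_kernel_nonint[OF False] x_def algebra_simps)
  also have "sin (pi * t) = sin (pi * x) * cos (pi * of_int p)"
    using sin_pi_add_int[of x "- p"] by (simp add: x_def)
  also have "sin (pi * x) * cos (pi * of_int p) / pi * (pi * cot (pi * x) / x - 1 / x\<^sup>2) = hilbert_kernel_deriv t p"
    unfolding hilbert_kernel_deriv_def nsinc_deriv_def x_def[symmetric] nsinc_def cot_def
    using x0 sx by (simp add: field_simps power2_eq_square)
  finally show ?thesis .
next
  case True
  then obtain k where t: "t = of_int k" by (auto elim: Ints_cases)
  have "((\<lambda>j. hilbert_kernel t j / of_int (p - j)) has_sum
      (\<Sum>j\<in>{- k}. hilbert_kernel t j / of_int (p - j))) {- k}"
    by (rule has_sum_finite) auto
  then have "((\<lambda>j. hilbert_kernel t j / of_int (p - j)) has_sum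
      cos (pi * of_int k) / of_int (p + k)) UNIV"
    by (subst has_sum_cong_neutral[where T = "{- k}" and g = "\<lambda>j. hilbert_kernel t j / of_int (p - j)"])
       (auto simp: t hilbert_kernel_int)
  also have "cos (pi * of_int k) / of_int (p + k) = hilbert_kernel_deriv t p"
  proof -
    have "cos (pi * (of_int k + of_int p)) = cos (pi * of_int k) * cos (pi * of_int p)"
      by (simp add: distrib_left cos_add)
    then have "cos (pi * of_int p) * cos (pi * (of_int k + of_int p)) = cos (pi * of_int k)"
      using cos_pi_int_sq[of p] by (metis mult.assoc mult.commute mult_1)
    then show ?thesis
      unfolding hilbert_kernel_deriv_def nsinc_deriv_def t
      using nsinc_of_int[of "k + p"]
      by (auto simp: add.commute simp del: cos_npi_int)
  qed
  finally show ?thesis .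
qed

lemma hilbert_kernel_sum_le:
  fixes z :: complex
  assumes "\<bar>t\<bar> \<le> real N" "finite F"
  shows "(\<Sum>m\<in>F. (cmod (of_real (hilbert_kernel t (m - n)) * z))\<^sup>2)
      \<le> (4 * real N + 1 + 4 * inv_sq_total) * (cmod z)\<^sup>2"
proof -
  have "(hilbert_kernel t j)\<^sup>2 = (nsinc (t + of_int j))\<^sup>2" for j
    using cos_pi_int_sq[of j] by (simp add: hilbert_kernel_def power_mult_distrib)
  then have "(\<Sum>m\<in>F. (cmod (of_real (hilbert_kernel t (m - n)) * z))\<^sup>2) =
      (\<Sum>m\<in>F. (nsinc (t + of_int (m - n)))\<^sup>2) * (cmod z)\<^sup>2"
    by (simp add: norm_mult power_mult_distrib sum_distrib_right)
  also have "(\<Sum>m\<in>F. (nsinc (t + of_int (m - n)))\<^sup>2) = (\<Sum>j\<in>(\<lambda>m. m - n) ` F. (nsinc (t + of_int j))\<^sup>2)"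
    by (subst sum.reindex) (auto simp: inj_on_def)
  also have "\<dots> \<le> 4 * real N + 1 + 4 * inv_sq_total"
    using assms by (intro nsinc_sq_sum_le) auto
  finally show ?thesis by (simp add: mult_right_mono)
qed

section \<open>Coordinates and unit vectors\<close>

lemma bounded_linear_ell2_nth: "bounded_linear (\<lambda>x. ell2_nth x m)"
  by (rule bounded_linear_intro[where K = 1])
     (auto simp: plus_ell2.rep_eq scaleR_ell2.rep_eq cmod_ell2_nth_le)

lemmas ell2_nth_has_sum = has_sum_bounded_linear[OF bounded_linear_ell2_nth]

text \<open>The vector whose only nonzero coordinate is \<open>z\<close>, at position \<open>n\<close>. Complex multiples are built in,
  since \<^typ>\<open>ell2\<close> carries only real scalars.\<close>

lift_definition ell2_single :: "int \<Rightarrow> complex \<Rightarrow> ell2" is "\<lambda>n z m. if m = n then z else 0"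
proof (rule square_summableI)
  fix n :: int and z :: complex and F :: "int set"
  assume "finite F"
  then have "(\<Sum>m\<in>F. (cmod (if m = n then z else 0))\<^sup>2) = (\<Sum>m\<in>F. if m = n then (cmod z)\<^sup>2 else 0)"
    by (intro sum.cong) auto
  also have "\<dots> \<le> (cmod z)\<^sup>2" using \<open>finite F\<close> by simp
  finally show "(\<Sum>m\<in>F. (cmod (if m = n then z else 0))\<^sup>2) \<le> (cmod z)\<^sup>2" .
qed

lemma bounded_linear_ell2_single: "bounded_linear (ell2_single n)"
proof (rule bounded_linear_intro[where K = 1])
  fix z :: complex
  have "(norm (ell2_single n z))\<^sup>2 \<le> (cmod z)\<^sup>2"
  proof (rule norm_ell2_sq_leI)
    fix F :: "int set" assume "finite F"
    then have "(\<Sum>m\<in>F. (cmod (ell2_nth (ell2_single n z) m))\<^sup>2) = (\<Sum>m\<in>F. if m = n then (cmod z)\<^sup>2 else 0)"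
      by (intro sum.cong) (auto simp: ell2_single.rep_eq)
    then show "(\<Sum>m\<in>F. (cmod (ell2_nth (ell2_single n z) m))\<^sup>2) \<le> (cmod z)\<^sup>2"
      using \<open>finite F\<close> by simp
  qed
  then have "norm (ell2_single n z) \<le> norm z" by (rule power2_le_imp_le) simp
  then show "norm (ell2_single n z) \<le> norm z * 1" by simp
qed (auto intro!: ell2_eqI simp: ell2_single.rep_eq plus_ell2.rep_eq scaleR_ell2.rep_eq)

lemma ell2_nth_sum_single:
  assumes "finite F"
  shows "ell2_nth (\<Sum>n\<in>F. ell2_single n (c n)) m = (if m \<in> F then c m else 0)"
proof -
  have "ell2_nth (\<Sum>n\<in>F. ell2_single n (c n)) m = (\<Sum>n\<in>F. ell2_nth (ell2_single n (c n)) m)"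
    by (rule linear_sum[OF bounded_linear.linear[OF bounded_linear_ell2_nth]])
  also have "\<dots> = (if m \<in> F then c m else 0)"
    using assms by (simp add: ell2_single.rep_eq)
  finally show ?thesis .
qed

text \<open>A tail of the expansion has squared norm at most \<open>\<parallel>a\<parallel>\<^sup>2\<close> minus the partial sum of \<open>\<Sum> \<bar>a n\<bar>\<^sup>2\<close>.\<close>

lemma has_sum_ell2_single: "((\<lambda>n. ell2_single n (ell2_nth a n)) has_sum a) UNIV"
proof -
  let ?P = "\<lambda>F. \<Sum>n\<in>F. ell2_single n (ell2_nth a n)"
  let ?s = "\<lambda>F. \<Sum>n\<in>F. (cmod (ell2_nth a n))\<^sup>2"
  have le: "norm (?P F - a) \<le> sqrt ((norm a)\<^sup>2 - ?s F)" if F: "finite F" for F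
  proof (rule real_le_rsqrt, rule norm_ell2_sq_leI)
    fix G :: "int set" assume G: "finite G"
    have "(\<Sum>n\<in>G. (cmod (ell2_nth (?P F - a) n))\<^sup>2) = (\<Sum>n\<in>G. if n \<in> - F then (cmod (ell2_nth a n))\<^sup>2 else 0)"
      by (intro sum.cong) (auto simp: minus_ell2.rep_eq ell2_nth_sum_single[OF F])
    also have "\<dots> = (\<Sum>n\<in>G - F. (cmod (ell2_nth a n))\<^sup>2)"
      using G by (simp only: sum.inter_restrict[symmetric] Diff_eq)
    also have "\<dots> = (\<Sum>n\<in>G \<union> F. (cmod (ell2_nth a n))\<^sup>2) - ?s F"
      using F G sum.subset_diff[of F "G \<union> F" "\<lambda>n. (cmod (ell2_nth a n))\<^sup>2"] by (simp add: Un_Diff)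
    also have "\<dots> \<le> (norm a)\<^sup>2 - ?s F"
      using F G by (intro diff_right_mono finite_sum_le_norm_ell2) auto
    finally show "(\<Sum>n\<in>G. (cmod (ell2_nth (?P F - a) n))\<^sup>2) \<le> (norm a)\<^sup>2 - ?s F" .
  qed
  have "(?s \<longlongrightarrow> (norm a)\<^sup>2) (finite_subsets_at_top UNIV)"
    unfolding norm_ell2_sq has_sum_def[symmetric]
    using square_summable_ell2_nth[of a] by (simp add: square_summable_def)
  then have "((\<lambda>F. sqrt ((norm a)\<^sup>2 - ?s F)) \<longlongrightarrow> sqrt ((norm a)\<^sup>2 - (norm a)\<^sup>2)) (finite_subsets_at_top UNIV)"
    by (intro tendsto_intros)
  then have lim: "((\<lambda>F. sqrt ((norm a)\<^sup>2 - ?s F)) \<longlongrightarrow> 0) (finite_subsets_at_top UNIV)" by simp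
  have "((\<lambda>F. ?P F - a) \<longlongrightarrow> 0) (finite_subsets_at_top UNIV)"
    by (rule Lim_null_comparison[OF eventually_finite_subsets_at_top_weakI lim]) (rule le)
  then show ?thesis unfolding has_sum_def by (rule LIM_zero_cancel)
qed

lemma norm_ell2_sum_single_le:
  assumes "finite F"
  shows "norm (\<Sum>n\<in>F. ell2_single n (ell2_nth a n)) \<le> norm a"
proof (rule power2_le_imp_le[OF norm_ell2_sq_leI])
  fix G :: "int set" assume "finite G"
  have "(\<Sum>m\<in>G. (cmod (ell2_nth (\<Sum>n\<in>F. ell2_single n (ell2_nth a n)) m))\<^sup>2) \<le> (\<Sum>m\<in>G. (cmod (ell2_nth a m))\<^sup>2)"
    by (intro sum_mono) (simp add: ell2_nth_sum_single[OF assms])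
  also have "\<dots> \<le> (norm a)\<^sup>2" by (rule finite_sum_le_norm_ell2[OF \<open>finite G\<close>])
  finally show "(\<Sum>m\<in>G. (cmod (ell2_nth (\<Sum>n\<in>F. ell2_single n (ell2_nth a n)) m))\<^sup>2) \<le> (norm a)\<^sup>2" .
qed simp

section \<open>Exponential orbits from coordinatewise differential equations\<close>

text \<open>A curve that is differentiable only coordinate by coordinate is still controlled by the norm of
  its formal derivative: the finite sections \<open>P F\<close> of the curve are differentiable in norm, projections
  do not increase norms, so the mean value inequality applies to each of them; then \<open>F\<close> grows.\<close>

lemma ell2_growth_nonneg:
  fixes v w :: "real \<Rightarrow> ell2"
  assumes der: "\<And>s m. ((\<lambda>s. ell2_nth (v s) m) has_vector_derivative ell2_nth (w s) m) (at s)"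
    and v0: "v 0 = 0"
    and bound: "\<And>s. 0 \<le> s \<Longrightarrow> s \<le> T \<Longrightarrow> norm (w s) \<le> C * s ^ n"
    and t: "0 \<le> t" "t \<le> T"
  shows "norm (v t) \<le> C * t ^ Suc n / real (Suc n)"
proof (cases "t = 0")
  case True
  then show ?thesis by (simp add: v0)
next
  case False
  define P where "P F x = (\<Sum>n\<in>F. ell2_single n (ell2_nth x n))" for F x
  have "norm (P F (v t)) \<le> C * t ^ Suc n / real (Suc n)" if F: "finite F" for F
  proof -
    have Pder: "((\<lambda>s. P F (v s)) has_vector_derivative P F (w s)) (at s)" for s
      unfolding P_def
      by (intro has_vector_derivative_sum bounded_linear.has_vector_derivative[OF bounded_linear_ell2_single] der)
    have gder: "((\<lambda>s. C * s ^ Suc n / real (Suc n)) has_vector_derivative C * s ^ n) (at s)" for s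
      unfolding has_real_derivative_iff_has_vector_derivative[symmetric]
      using DERIV_cmult[OF DERIV_pow[of "Suc n" s], of "C / real (Suc n)"] by simp
    have "norm (P F (v t) - P F (v 0)) \<le> C * t ^ Suc n / real (Suc n) - C * 0 ^ Suc n / real (Suc n)"
    proof (rule differentiable_bound_general[where f = "\<lambda>s. P F (v s)" and f' = "\<lambda>s. P F (w s)"
          and \<phi> = "\<lambda>s. C * s ^ Suc n / real (Suc n)" and \<phi>' = "\<lambda>s. C * s ^ n"])
      show "0 < t" using False t by simp
      show "continuous_on {0..t} (\<lambda>s. P F (v s))"
        using Pder by (meson continuous_at_imp_continuous_on has_vector_derivative_continuous)
      show "continuous_on {0..t} (\<lambda>s. C * s ^ Suc n / real (Suc n))"
        by (intro continuous_intros) auto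
      fix s assume s: "0 < s" "s < t"
      have "norm (P F (w s)) \<le> norm (w s)"
        unfolding P_def by (rule norm_ell2_sum_single_le[OF F])
      also have "\<dots> \<le> C * s ^ n" using s t by (intro bound) auto
      finally show "norm (P F (w s)) \<le> C * s ^ n" .
    qed (use Pder gder in auto)
    moreover have "P F (v 0) = 0"
      unfolding P_def v0 by (intro ell2_eqI) (simp add: ell2_nth_sum_single[OF F] zero_ell2.rep_eq)
    ultimately show ?thesis by simp
  qed
  then have "\<forall>\<^sub>F F in finite_subsets_at_top UNIV. norm (P F (v t)) \<le> C * t ^ Suc n / real (Suc n)"
    by (intro eventually_finite_subsets_at_top_weakI)
  moreover have "((\<lambda>F. norm (P F (v t))) \<longlongrightarrow> norm (v t)) (finite_subsets_at_top UNIV)"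
    unfolding P_def using has_sum_ell2_single[of "v t"] unfolding has_sum_def by (rule tendsto_norm)
  ultimately show ?thesis
    by (intro tendsto_upperbound[OF _ _ finite_subsets_at_top_neq_bot])
qed

lemma ell2_growth:
  fixes v w :: "real \<Rightarrow> ell2"
  assumes der: "\<And>s m. ((\<lambda>s. ell2_nth (v s) m) has_vector_derivative ell2_nth (w s) m) (at s)"
    and v0: "v 0 = 0"
    and bound: "\<And>s. \<bar>s\<bar> \<le> T \<Longrightarrow> norm (w s) \<le> C * \<bar>s\<bar> ^ n"
    and t: "\<bar>t\<bar> \<le> T"
  shows "norm (v t) \<le> C * \<bar>t\<bar> ^ Suc n / real (Suc n)"
proof (cases "t \<ge> 0")
  case True
  have "norm (v t) \<le> C * t ^ Suc n / real (Suc n)"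
  proof (rule ell2_growth_nonneg[OF der v0, where T = T])
    fix s assume "0 \<le> s" "s \<le> T"
    then show "norm (w s) \<le> C * s ^ n" using bound[of s] by simp
  qed (use t True in auto)
  then show ?thesis using True by simp
next
  case False
  have "norm (v (- (- t))) \<le> C * (- t) ^ Suc n / real (Suc n)"
  proof (rule ell2_growth_nonneg[where v = "\<lambda>s. v (- s)" and w = "\<lambda>s. - w (- s)" and T = T])
    fix s m
    have "((uminus :: real \<Rightarrow> real) has_real_derivative - 1) (at s)"
      by (auto intro!: derivative_eq_intros)
    from vector_diff_chain_at[OF this[unfolded has_real_derivative_iff_has_vector_derivative] der, of m]
    show "((\<lambda>s. ell2_nth (v (- s)) m) has_vector_derivative ell2_nth (- w (- s)) m) (at s)"
      by (simp add: o_def uminus_ell2.rep_eq)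
  next
    fix s assume "0 \<le> s" "s \<le> T"
    then show "norm (- w (- s)) \<le> C * s ^ n" using bound[of "- s"] by simp
  qed (use False t v0 in auto)
  then show ?thesis using False by simp
qed

text \<open>The remainder of order \<open>n + 1\<close> vanishes at \<open>0\<close> and its coordinatewise derivative is \<open>A\<close> applied to
  the remainder of order \<open>n\<close>, so the bound is integrated once in each induction step.\<close>

lemma ell2_taylor_remainder:
  fixes u :: "real \<Rightarrow> ell2" and A :: "ell2 \<Rightarrow>\<^sub>L ell2"
  assumes der: "\<And>s m. ((\<lambda>s. ell2_nth (u s) m) has_vector_derivative ell2_nth (A (u s)) m) (at s)"
    and bound: "\<And>s. \<bar>s\<bar> \<le> T \<Longrightarrow> norm (u s) \<le> M"
    and t: "\<bar>t\<bar> \<le> T"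
  shows "norm (u t - (\<Sum>k<n. (t ^ k / fact k) *\<^sub>R blinfun_pow A k (u 0))) \<le> M * (norm A * \<bar>t\<bar>) ^ n / fact n"
  using t
proof (induction n arbitrary: t)
  case 0
  then show ?case using bound by simp
next
  case (Suc n)
  define R where "R n t = u t - (\<Sum>k<n. (t ^ k / fact k) *\<^sub>R blinfun_pow A k (u 0))" for n t
  have "norm (R (Suc n) t) \<le> M * norm A ^ Suc n / fact n * \<bar>t\<bar> ^ Suc n / real (Suc n)"
  proof (rule ell2_growth[where w = "\<lambda>s. A (R n s)" and T = T])
    fix s m
    have R_nth: "ell2_nth (R n s) m = ell2_nth (u s) m - (\<Sum>k<n. (s ^ k / fact k) *\<^sub>R ell2_nth (blinfun_pow A k (u 0)) m)" for n s
      unfolding R_def minus_ell2.rep_eq linear_sum[OF bounded_linear.linear[OF bounded_linear_ell2_nth]]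
      by (simp add: scaleR_ell2.rep_eq)
    have coeff_der: "((\<lambda>s. (s ^ k / fact k) *\<^sub>R c) has_vector_derivative (of_nat k * s ^ (k - 1) / fact k) *\<^sub>R c) (at s)"
      for k and c :: complex
      by (auto intro!: derivative_eq_intros)
    have "((\<lambda>s. ell2_nth (R (Suc n) s) m) has_vector_derivative
       ell2_nth (A (u s)) m - (\<Sum>k<Suc n. (of_nat k * s ^ (k - 1) / fact k) *\<^sub>R ell2_nth (blinfun_pow A k (u 0)) m)) (at s)"
      unfolding R_nth by (intro has_vector_derivative_diff has_vector_derivative_sum der coeff_der)
    also have "(\<Sum>k<Suc n. (of_nat k * s ^ (k - 1) / fact k) *\<^sub>R ell2_nth (blinfun_pow A k (u 0)) m)
        = (\<Sum>k<n. (s ^ k / fact k) *\<^sub>R ell2_nth (A (blinfun_pow A k (u 0))) m)"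
    proof -
      have "of_nat (Suc k) * s ^ k / fact (Suc k) = s ^ k / fact k" for k
        by (simp add: field_simps del: of_nat_Suc)
      then show ?thesis
        unfolding sum.lessThan_Suc_shift by (simp add: blinfun_pow_def del: of_nat_Suc fact_Suc)
    qed
    also have "ell2_nth (A (u s)) m - \<dots> = ell2_nth (A (R n s)) m"
      unfolding R_def blinfun.diff_right blinfun.sum_right blinfun.scaleR_right
        minus_ell2.rep_eq linear_sum[OF bounded_linear.linear[OF bounded_linear_ell2_nth]]
      by (simp add: scaleR_ell2.rep_eq)
    finally show "((\<lambda>s. ell2_nth (R (Suc n) s) m) has_vector_derivative ell2_nth (A (R n s)) m) (at s)" .
  next
    show "R (Suc n) 0 = 0"
      unfolding R_def sum.lessThan_Suc_shift by (simp add: blinfun_pow_def)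
  next
    fix s assume s: "\<bar>s\<bar> \<le> T"
    have "norm (A (R n s)) \<le> norm A * norm (R n s)" by (rule norm_blinfun)
    also have "\<dots> \<le> norm A * (M * (norm A * \<bar>s\<bar>) ^ n / fact n)"
      unfolding R_def by (intro mult_left_mono Suc.IH s) auto
    finally show "norm (A (R n s)) \<le> M * norm A ^ Suc n / fact n * \<bar>s\<bar> ^ n"
      by (simp add: power_mult_distrib mult_ac)
  qed (rule Suc.prems)
  also have "\<dots> = M * (norm A * \<bar>t\<bar>) ^ Suc n / fact (Suc n)"
    by (simp add: power_mult_distrib mult_ac)
  finally show ?case unfolding R_def .
qed

lemma blinfun_exp_sums: "(\<lambda>k. (t ^ k / fact k) *\<^sub>R blinfun_pow T k x) sums blinfun_exp t T x"
proof -
  have "(\<lambda>k. (t ^ k / fact k) *\<^sub>R blinfun_pow T k) sums blinfun_exp t T"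
    unfolding blinfun_exp_def by (rule summable_sums[OF summable_blinfun_exp])
  from bounded_linear.sums[OF blinfun.bounded_linear_left this, of x]
  show ?thesis by (simp add: blinfun.scaleR_left)
qed

text \<open>Uniqueness for the equation \<open>u' = A u\<close>: a locally bounded curve that satisfies the equation
  in every coordinate is the exponential orbit of its initial value, since its Taylor remainders tend
  to zero.\<close>

lemma blinfun_exp_eqI:
  fixes u :: "real \<Rightarrow> ell2" and A :: "ell2 \<Rightarrow>\<^sub>L ell2"
  assumes der: "\<And>s m. ((\<lambda>s. ell2_nth (u s) m) has_vector_derivative ell2_nth (A (u s)) m) (at s)"
    and bound: "\<And>s. \<bar>s\<bar> \<le> \<bar>t\<bar> \<Longrightarrow> norm (u s) \<le> M"
  shows "blinfun_exp t A (u 0) = u t"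
proof -
  let ?S = "\<lambda>n. \<Sum>k<n. (t ^ k / fact k) *\<^sub>R blinfun_pow A k (u 0)"
  have "(\<lambda>n. M * (norm A * \<bar>t\<bar>) ^ n / fact n) \<longlonglongrightarrow> M * 0"
    using tendsto_mult[OF tendsto_const summable_LIMSEQ_zero[OF summable_exp[of "norm A * \<bar>t\<bar>"]], of M]
    by (simp add: divide_inverse mult_ac)
  then have lim: "(\<lambda>n. M * (norm A * \<bar>t\<bar>) ^ n / fact n) \<longlonglongrightarrow> 0" by simp
  have "norm (u t - ?S n) \<le> M * (norm A * \<bar>t\<bar>) ^ n / fact n" for n
    by (rule ell2_taylor_remainder[OF der bound order.refl])
  then have "(\<lambda>n. u t - ?S n) \<longlonglongrightarrow> 0"
    by (intro Lim_null_comparison[OF always_eventually lim]) blast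
  then have "(\<lambda>n. u t - (u t - ?S n)) \<longlonglongrightarrow> u t - 0" by (rule tendsto_diff[OF tendsto_const])
  then have "?S \<longlonglongrightarrow> u t" by simp
  moreover have "?S \<longlonglongrightarrow> blinfun_exp t A (u 0)"
    using blinfun_exp_sums[of t A "u 0"] by (simp add: sums_def)
  ultimately show ?thesis by (rule LIMSEQ_unique[rotated])
qed

section \<open>The group generated by the discrete Hilbert transform\<close>

text \<open>The kernel translated by \<open>n\<close> and multiplied by \<open>z\<close>, that is, the candidate for \<open>exp (t H)\<close> applied to
  the vector with the single coordinate \<open>z\<close> at \<open>n\<close>. With \<open>n\<close> and \<open>z\<close> as
  parameters, translations and complex scalars are absorbed into the differential equation, which is
  invariant under both.\<close>

lift_definition hilbert_kernel_vec :: "int \<Rightarrow> complex \<Rightarrow> real \<Rightarrow> ell2" is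
  "\<lambda>n z t m. of_real (hilbert_kernel t (m - n)) * z"
proof -
  fix n z and t :: real
  obtain N :: nat where "\<bar>t\<bar> \<le> real N" using real_arch_simple by blast
  then show "square_summable (\<lambda>m. of_real (hilbert_kernel t (m - n)) * z)"
    by (rule square_summableI[OF hilbert_kernel_sum_le])
qed

lemma norm_hilbert_kernel_vec_le:
  assumes "\<bar>t\<bar> \<le> real N"
  shows "norm (hilbert_kernel_vec n z t) \<le> sqrt ((4 * real N + 1 + 4 * inv_sq_total) * (cmod z)\<^sup>2)"
  by (rule real_le_rsqrt, rule norm_ell2_sq_leI)
     (simp add: hilbert_kernel_vec.rep_eq hilbert_kernel_sum_le[OF assms])

lemma hilbert_op_kernel_vec:
  "ell2_nth (hilbert_op (hilbert_kernel_vec n z t)) m = of_real (hilbert_kernel_deriv t (m - n)) * z"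
proof (rule has_sum_unique)
  show "((\<lambda>j. ell2_nth (hilbert_kernel_vec n z t) j / of_int (m - j)) has_sum
      ell2_nth (hilbert_op (hilbert_kernel_vec n z t)) m) UNIV"
    unfolding hilbert_op.rep_eq hilbert_map.rep_eq
    by (rule hilbert_coeff_has_sum[OF square_summable_ell2_nth])
  have "((\<lambda>j. of_real (hilbert_kernel t j / of_int (m - n - j)) * z) has_sum
      of_real (hilbert_kernel_deriv t (m - n)) * z) UNIV"
    by (intro has_sum_cmult_left has_sum_of_real hilbert_kernel_transform)
  also have "?this \<longleftrightarrow> ((\<lambda>j. ell2_nth (hilbert_kernel_vec n z t) j / of_int (m - j)) has_sum
      of_real (hilbert_kernel_deriv t (m - n)) * z) UNIV"
    by (rule has_sum_reindex_bij_witness[where i = "\<lambda>j. j - n" and j = "\<lambda>j. j + n"])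
       (auto simp: hilbert_kernel_vec.rep_eq algebra_simps)
  finally show "((\<lambda>j. ell2_nth (hilbert_kernel_vec n z t) j / of_int (m - j)) has_sum
      of_real (hilbert_kernel_deriv t (m - n)) * z) UNIV" .
qed

lemma blinfun_exp_hilbert_single:
  "blinfun_exp t hilbert_op (ell2_single n z) = hilbert_kernel_vec n z t"
proof -
  obtain N :: nat where N: "\<bar>t\<bar> \<le> real N" using real_arch_simple by blast
  have "blinfun_exp t hilbert_op (hilbert_kernel_vec n z 0) = hilbert_kernel_vec n z t"
  proof (rule blinfun_exp_eqI)
    fix s m
    have "((\<lambda>s. of_real (hilbert_kernel s (m - n)) * z) has_vector_derivative
        of_real (hilbert_kernel_deriv s (m - n)) * z) (at s)"
      by (intro has_vector_derivative_mult_left has_vector_derivative_of_real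
          has_real_derivative_hilbert_kernel)
    then show "((\<lambda>s. ell2_nth (hilbert_kernel_vec n z s) m) has_vector_derivative
        ell2_nth (hilbert_op (hilbert_kernel_vec n z s)) m) (at s)"
      unfolding hilbert_op_kernel_vec by (simp add: hilbert_kernel_vec.rep_eq)
  next
    fix s assume "\<bar>s\<bar> \<le> \<bar>t\<bar>"
    with N show "norm (hilbert_kernel_vec n z s) \<le> sqrt ((4 * real N + 1 + 4 * inv_sq_total) * (cmod z)\<^sup>2)"
      by (intro norm_hilbert_kernel_vec_le) simp
  qed
  moreover have "hilbert_kernel_vec n z 0 = ell2_single n z"
    using hilbert_kernel_int[of 0]
    by (intro ell2_eqI) (simp add: hilbert_kernel_vec.rep_eq ell2_single.rep_eq)
  ultimately show ?thesis by simp
qed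

text \<open>The matrix of \<open>exp (t H)\<close>, read off by applying this bounded operator to the expansion of \<open>a\<close> in unit
  vectors.\<close>

lemma blinfun_exp_hilbert_nth:
  "((\<lambda>n. of_real (hilbert_kernel t (m - n)) * ell2_nth a n) has_sum
      ell2_nth (blinfun_exp t hilbert_op a) m) UNIV"
  using ell2_nth_has_sum[OF has_sum_bounded_linear[OF blinfun.bounded_linear_right
        has_sum_ell2_single[of a], of "blinfun_exp t hilbert_op"], of m]
  by (simp add: blinfun_exp_hilbert_single hilbert_kernel_vec.rep_eq)

lemma blinfun_exp_hilbert_int:
  "ell2_nth (blinfun_exp (of_int k) hilbert_op a) m = of_real (cos (pi * of_int k)) * ell2_nth a (m + k)"
proof (rule has_sum_unique[OF blinfun_exp_hilbert_nth])
  have "((\<lambda>n. of_real (hilbert_kernel (of_int k) (m - n)) * ell2_nth a n) has_sum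
     (\<Sum>n\<in>{m + k}. of_real (hilbert_kernel (of_int k) (m - n)) * ell2_nth a n)) {m + k}"
    by (rule has_sum_finite) auto
  then show "((\<lambda>n. of_real (hilbert_kernel (of_int k) (m - n)) * ell2_nth a n) has_sum
     of_real (cos (pi * of_int k)) * ell2_nth a (m + k)) UNIV"
    by (subst has_sum_cong_neutral[where T = "{m + k}" and
          g = "\<lambda>n. of_real (hilbert_kernel (of_int k) (m - n)) * ell2_nth a n"])
       (auto simp: hilbert_kernel_int)
qed

text \<open>A signed shift is an isometry. Together with the summable weights this makes the sampling series
  absolutely convergent.\<close>

lemma norm_blinfun_exp_hilbert_int: "norm (blinfun_exp (of_int k) hilbert_op a) = norm a"
proof -
  have "(norm (blinfun_exp (of_int k) hilbert_op a))\<^sup>2 = (\<Sum>\<^sub>\<infinity>m. (cmod (ell2_nth a (m + k)))\<^sup>2)"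
    unfolding norm_ell2_sq blinfun_exp_hilbert_int
    by (intro infsum_cong) (simp add: norm_mult)
  also have "\<dots> = (\<Sum>\<^sub>\<infinity>m. (cmod (ell2_nth a m))\<^sup>2)"
    by (rule infsum_reindex_bij_witness[where i = "\<lambda>m. m - k" and j = "\<lambda>m. m + k"]) auto
  finally show ?thesis unfolding norm_ell2_sq[symmetric] by simp
qed

section \<open>The sampling series\<close>

lemma sampling_series_summable:
  "(\<lambda>k::int. nsinc (t - of_int k) *\<^sub>R
      ((blinfun_exp (of_int k) hilbert_op a - a) /\<^sub>R of_int k)) summable_on UNIV"
proof (rule abs_summable_summable, rule summable_on_comparison_test)
  show "(\<lambda>k::int. \<bar>nsinc (t - of_int k) / of_int k\<bar> * (2 * norm a)) summable_on UNIV"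
    by (intro summable_on_cmult_left nsinc_over_summable)
  fix k :: int
  have "norm (blinfun_exp (of_int k) hilbert_op a - a) \<le> 2 * norm a"
    using norm_triangle_ineq4[of "blinfun_exp (of_int k) hilbert_op a" a]
    by (simp add: norm_blinfun_exp_hilbert_int)
  then have "\<bar>nsinc (t - of_int k) / of_int k\<bar> * norm (blinfun_exp (of_int k) hilbert_op a - a)
      \<le> \<bar>nsinc (t - of_int k) / of_int k\<bar> * (2 * norm a)"
    by (rule mult_left_mono) simp
  then show "norm (nsinc (t - of_int k) *\<^sub>R ((blinfun_exp (of_int k) hilbert_op a - a) /\<^sub>R of_int k))
      \<le> \<bar>nsinc (t - of_int k) / of_int k\<bar> * (2 * norm a)"
    by (simp add: abs_mult divide_inverse mult_ac)
qed auto

text \<open>For \<open>k \<noteq> 0\<close> the coefficient of \<open>a (m + k)\<close> in the series is, with \<open>s = sin (\<pi> t)\<close>,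
  \<open>s / (\<pi> k (t - k)) = (s / (\<pi> (t - k)) + s / (\<pi> k)) / t\<close>. The first part sums to the coordinate of
  \<open>exp (t H) a\<close> without its \<open>k = 0\<close> term \<open>nsinc t * a m\<close>, the second to \<open>- t * nsinc t\<close> times that of \<open>H a\<close>.
  The remaining multiple of \<open>a m\<close> is a cosecant series.\<close>

lemma sampling_series_nth:
  assumes t: "t \<notin> \<int>"
  shows "((\<lambda>k::int. ell2_nth (nsinc (t - of_int k) *\<^sub>R
      ((blinfun_exp (of_int k) hilbert_op a - a) /\<^sub>R of_int k)) m) has_sum
     (ell2_nth (blinfun_exp t hilbert_op a) m - ell2_nth a m
        - of_real (t * nsinc t) * ell2_nth (hilbert_op a) m) / of_real t) UNIV"
proof -
  let ?E = "ell2_nth (blinfun_exp t hilbert_op a) m" and ?H = "ell2_nth (hilbert_op a) m"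
    and ?a = "\<lambda>k. ell2_nth a (m + k)"
  have t0: "t \<noteq> 0" and tk: "t - of_int k \<noteq> 0" for k :: int using t by auto
  have st: "sin (pi * t) \<noteq> 0" using t by (simp add: sin_pi_eq_0_iff)
  have E: "((\<lambda>k. of_real (hilbert_kernel t (- k)) * ?a k) has_sum ?E) UNIV"
    using blinfun_exp_hilbert_nth[of t m a]
    by (subst has_sum_reindex_bij_witness[where i = "\<lambda>n. n - m" and j = "\<lambda>k. m + k" and T = UNIV
          and h = "\<lambda>n. of_real (hilbert_kernel t (m - n)) * ell2_nth a n" and s' = ?E]) auto
  have "((\<lambda>n. ell2_nth a n / of_int (m - n)) has_sum ?H) UNIV"
    unfolding hilbert_op.rep_eq hilbert_map.rep_eq
    by (rule hilbert_coeff_has_sum[OF square_summable_ell2_nth])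
  then have H: "((\<lambda>k. ?a k / of_int (- k)) has_sum ?H) UNIV"
    by (subst has_sum_reindex_bij_witness[where i = "\<lambda>n. n - m" and j = "\<lambda>k. m + k" and T = UNIV
          and h = "\<lambda>n. ell2_nth a n / of_int (m - n)" and s' = ?H]) auto
  have Z: "((\<lambda>k. if k = 0 then of_real (nsinc t) * ?a 0 else 0) has_sum of_real (nsinc t) * ?a 0) (UNIV :: int set)"
  proof -
    have "((\<lambda>k. of_real (nsinc t) * ?a 0) has_sum (\<Sum>k\<in>{0::int}. of_real (nsinc t) * ?a 0)) {0::int}"
      by (rule has_sum_finite) auto
    then show ?thesis
      by (subst has_sum_cong_neutral[where T = "{0}" and g = "\<lambda>k. of_real (nsinc t) * ?a 0"]) auto
  qed
  have C: "((\<lambda>k::int. of_real (sin (pi * t) / pi * (cos (pi * of_int k) / (of_int k * (t - of_int k)))) * ell2_nth a m)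
      has_sum (of_real (sin (pi * t) / pi * (pi / (t * sin (pi * t)) - 1 / t\<^sup>2)) * ell2_nth a m)) UNIV"
    by (intro has_sum_cmult_left has_sum_of_real has_sum_cmult_right cosec_partial_fractions t)
  (* The summand of the sampling series, assembled from the four series with known sums. *)
  define G where "G k = (of_real (hilbert_kernel t (- k)) * ?a k + - (if k = 0 then of_real (nsinc t) * ?a 0 else 0)
        + - (of_real (t * nsinc t) * (?a k / of_int (- k)))) * of_real (1 / t)
      + - (of_real (sin (pi * t) / pi * (cos (pi * of_int k) / (of_int k * (t - of_int k)))) * ell2_nth a m)" for k :: int
  have G_sum: "(G has_sum ((?E + - (of_real (nsinc t) * ?a 0) + - (of_real (t * nsinc t) * ?H)) * of_real (1 / t)
      + - (of_real (sin (pi * t) / pi * (pi / (t * sin (pi * t)) - 1 / t\<^sup>2)) * ell2_nth a m))) UNIV"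
    unfolding G_def
    by (intro has_sum_add has_sum_cmult_left has_sum_uminusI has_sum_cmult_right E Z H C)
  have G_eq: "G k = ell2_nth (nsinc (t - of_int k) *\<^sub>R
      ((blinfun_exp (of_int k) hilbert_op a - a) /\<^sub>R of_int k)) m" for k :: int
  proof (cases "k = 0")
    case True
    then show ?thesis by (simp add: G_def hilbert_kernel_def zero_ell2.rep_eq scaleR_ell2.rep_eq)
  next
    case False
    define c s where "c = cos (pi * of_int k)" and "s = sin (pi * t)"
    have cc: "c * c = 1" unfolding c_def by (rule cos_pi_int_sq)
    have nk: "nsinc (t - of_int k) = c * s / (pi * (t - of_int k))"
      unfolding c_def s_def by (rule nsinc_diff_int[OF t])
    have at_shift: "(s / (pi * (t - of_int k)) + t * (s / (pi * t)) * (1 / of_int k)) * (1 / t)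
        = c * c * s / (pi * (t - of_int k)) * (1 / of_int k)"
      unfolding cc using t0 tk[of k] False by (simp add: field_simps)
    have at_m: "s / pi * (c / (of_int k * (t - of_int k))) = c * s / (pi * (t - of_int k)) * (1 / of_int k)"
      by (simp add: mult_ac)
    have "G k = of_real ((s / (pi * (t - of_int k)) + t * (s / (pi * t)) * (1 / of_int k)) * (1 / t)) * ?a k
        - of_real (s / pi * (c / (of_int k * (t - of_int k)))) * ell2_nth a m"
      using False t0 unfolding G_def hilbert_kernel_nonint[OF t] c_def[symmetric] s_def[symmetric]
      by (simp add: nsinc_def s_def[symmetric] ring_distribs)
    also have "\<dots> = of_real (c * s / (pi * (t - of_int k)) * (1 / of_int k)) * (of_real c * ?a k - ell2_nth a m)"
      unfolding at_shift at_m by (simp add: ring_distribs)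
    also have "\<dots> = ell2_nth (nsinc (t - of_int k) *\<^sub>R
        ((blinfun_exp (of_int k) hilbert_op a - a) /\<^sub>R of_int k)) m"
      unfolding nk scaleR_ell2.rep_eq minus_ell2.rep_eq blinfun_exp_hilbert_int c_def[symmetric]
      by (simp add: scaleR_conv_of_real divide_inverse)
    finally show ?thesis .
  qed
  have at_limit: "sin (pi * t) / pi * (pi / (t * sin (pi * t)) - 1 / t\<^sup>2) = (1 - nsinc t) * (1 / t)"
    using t0 st by (simp add: nsinc_def field_simps power2_eq_square)
  have limit_eq: "(?E + - (of_real (nsinc t) * ?a 0) + - (of_real (t * nsinc t) * ?H)) * of_real (1 / t)
      + - (of_real (sin (pi * t) / pi * (pi / (t * sin (pi * t)) - 1 / t\<^sup>2)) * ell2_nth a m)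
     = (?E - ell2_nth a m - of_real (t * nsinc t) * ?H) / of_real t"
    unfolding at_limit using t0 by (simp add: field_simps)
  show ?thesis using G_sum unfolding G_eq limit_eq .
qed

theorem theorem3p5:
  fixes a :: ell2 and t :: real
  shows "(\<lambda>k::int. nsinc (t - of_int k) *\<^sub>R
            ((blinfun_exp (of_int k) hilbert_op a - a) /\<^sub>R of_int k)) summable_on (UNIV - {0})
    \<and> blinfun_exp t hilbert_op a =
        a + (t * nsinc t) *\<^sub>R hilbert_op a
          + t *\<^sub>R (\<Sum>\<^sub>\<infinity>k\<in>UNIV - {0 :: int}. nsinc (t - of_int k) *\<^sub>R
              ((blinfun_exp (of_int k) hilbert_op a - a) /\<^sub>R of_int k))"
proof
  let ?f = "\<lambda>k::int. nsinc (t - of_int k) *\<^sub>R ((blinfun_exp (of_int k) hilbert_op a - a) /\<^sub>R of_int k)"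
  show "?f summable_on (UNIV - {0})"
    using sampling_series_summable by (rule summable_on_subset_banach) simp
  have drop0: "infsum ?f (UNIV - {0}) = infsum ?f UNIV"
    by (rule infsum_cong_neutral) auto
  show "blinfun_exp t hilbert_op a = a + (t * nsinc t) *\<^sub>R hilbert_op a + t *\<^sub>R infsum ?f (UNIV - {0})"
  proof (cases "t \<in> \<int>")
    case True
    then obtain l where l: "t = of_int l" by (auto elim: Ints_cases)
    (* nsinc vanishes at the nonzero integers, so the series reduces to its term at k = t. *)
    have f0: "?f k = 0" if "k \<noteq> l" for k
    proof -
      have "t - of_int k = of_int (l - k)" by (simp add: l)
      then have "nsinc (t - of_int k) = 0" using that by (simp only: nsinc_of_int) simp
      then show ?thesis by simp
    qed
    have "infsum ?f UNIV = infsum ?f {l}"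
      by (rule infsum_cong_neutral) (use f0 in auto)
    also have "\<dots> = (blinfun_exp t hilbert_op a - a) /\<^sub>R t"
      using nsinc_of_int[of 0] by (simp add: l)
    finally have sum: "infsum ?f UNIV = (blinfun_exp t hilbert_op a - a) /\<^sub>R t" .
    show ?thesis
    proof (cases "l = 0")
      (* For l = 0 the remaining term is the excluded one, and the factor t annihilates the series. *)
      case True
      have "blinfun_exp (of_int 0) hilbert_op a = a"
        by (rule ell2_eqI) (simp only: blinfun_exp_hilbert_int, simp)
      then show ?thesis by (simp add: l True)
    next
      case False
      then show ?thesis unfolding drop0 sum using nsinc_of_int[of l] by (simp add: l)
    qed
  next
    case False
    then have t0: "t \<noteq> 0" by auto
    have "ell2_nth (infsum ?f UNIV) m = (ell2_nth (blinfun_exp t hilbert_op a) m - ell2_nth a m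
        - of_real (t * nsinc t) * ell2_nth (hilbert_op a) m) / of_real t" for m
      by (rule has_sum_unique[OF ell2_nth_has_sum[OF has_sum_infsum[OF sampling_series_summable]]
            sampling_series_nth[OF False]])
    then show ?thesis
      unfolding drop0 using t0
      by (intro ell2_eqI) (simp add: plus_ell2.rep_eq scaleR_ell2.rep_eq scaleR_conv_of_real)
  qed
qed

end
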